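(* Let $k$ be an algebraically closed field of characteristic $p>0$, let $r\geq 1$ be an integer with $p^r+1>3$, and set $d=p^r+1$. Let $X\subset\mathbb{P}^{d}_k$ be the Fermat hypersurface defined by $X_0^d+X_1^d+\cdots+X_d^d=0$. If there exists an integer $N_0$ such that for all integers $e\geq N_0$ there is a very free rational curve of degree $e$ on $X$, then $N_0>p^r(p^r-1)$.
   Context: A rational curve on $X$ is a morphism $f:\mathbb{P}^1_k\to X$; its degree is the degree of the line bundle $f^*\mathcal{O}_{\mathbb{P}^d}(1)$ on $\mathbb{P}^1_k$. Let $T_X$ be the tangent bundle of the smooth projective variety $X$. The rational curve $f$ is called very free if $f^*T_X$ is ample, i.e. $f^*T_X$ is a direct sum of line bundles $\mathcal{O}_{\mathbb{P}^1}(a_i)$ with all $a_i>0$. *)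

theory Defs
  imports
    "HOL-Analysis.Abstract_Topology"
    "HOL-Computational_Algebra.Computational_Algebra"
begin

text \<open>
  Classical (closed-point) language over an algebraically closed field \<open>'k\<close>.  A vector of
  \<open>k^(n+1)\<close> is a function \<open>nat \<Rightarrow> 'k\<close> vanishing beyond \<open>n\<close>.  A point of projective space is
  a line with the origin removed, i.e. the set of all its homogeneous coordinate vectors.
\<close>

type_synonym 'k ppoint = "(nat \<Rightarrow> 'k) set"

definition proj_space :: "nat \<Rightarrow> 'k::field ppoint set" where
  "proj_space n = {{(\<lambda>i. c * v i) | c. c \<noteq> 0} | v. v \<noteq> (\<lambda>_. 0) \<and> (\<forall>i>n. v i = 0)}"

text \<open>
  Homogeneous polynomials of degree \<open>m\<close> in \<open>X\<^sub>0, \<dots>, X\<^sub>n\<close>, as polynomial functions (the base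
  field will be infinite); the zero function is a form of every degree.
\<close>

definition form :: "nat \<Rightarrow> nat \<Rightarrow> ((nat \<Rightarrow> 'k::field) \<Rightarrow> 'k) \<Rightarrow> bool" where
  "form n m F \<longleftrightarrow> (\<exists>(A :: (nat \<Rightarrow> nat) set) c. finite A \<and> (\<forall>\<alpha>\<in>A. (\<Sum>i\<le>n. \<alpha> i) = m) \<and>
     F = (\<lambda>v. \<Sum>\<alpha>\<in>A. c \<alpha> * (\<Prod>i\<le>n. v i ^ \<alpha> i)))"

text \<open>The Zariski topology, generated by the principal open sets \<open>F \<noteq> 0\<close>.\<close>

definition zariski :: "nat \<Rightarrow> 'k::field ppoint topology" where
  "zariski n = topology_generated_by
     {{x \<in> proj_space n. \<forall>v\<in>x. F v \<noteq> 0} | F. \<exists>m. form n m F}"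

abbreviation zariski_on :: "nat \<Rightarrow> 'k::field ppoint set \<Rightarrow> 'k ppoint topology" where
  "zariski_on n X \<equiv> subtopology (zariski n) X"

text \<open>
  Throughout, \<open>X\<close> is a subvariety of \<open>n\<close>-dimensional projective space.  The function \<open>g\<close> is
  regular at \<open>x\<close> if on a neighbourhood of \<open>x\<close> in \<open>X\<close> it is a quotient of two forms of equal
  degree.  Only the germ of \<open>g\<close> at \<open>x\<close> matters, so the functions regular at \<open>x\<close>, up to
  agreement near \<open>x\<close>, are the local ring of \<open>X\<close> at \<open>x\<close>.
\<close>

definition regular_at ::
  "nat \<Rightarrow> 'k::field ppoint set \<Rightarrow> 'k ppoint \<Rightarrow> ('k ppoint \<Rightarrow> 'k) \<Rightarrow> bool" where
  "regular_at n X x g \<longleftrightarrow>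
     (\<exists>U m G H. openin (zariski_on n X) U \<and> x \<in> U \<and> form n m G \<and> form n m H \<and>
        (\<forall>y\<in>U. \<forall>v\<in>y. H v \<noteq> 0 \<and> g y = G v / H v))"

definition variety_morphism ::
  "nat \<Rightarrow> 'k::field ppoint set \<Rightarrow> nat \<Rightarrow> 'k ppoint set \<Rightarrow> ('k ppoint \<Rightarrow> 'k ppoint) \<Rightarrow> bool" where
  "variety_morphism n X m Y f \<longleftrightarrow>
     continuous_map (zariski_on n X) (zariski_on m Y) f \<and>
     (\<forall>x\<in>X. \<forall>g. regular_at m Y (f x) g \<longrightarrow> regular_at n X x (g \<circ> f))"

text \<open>
  A vector bundle is given by its fibres, which are linear subspaces of a function space
  \<open>'a \<Rightarrow> 'k\<close> (with pointwise operations), and by the predicate telling which (set-theoretic)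
  sections \<open>s\<close> are regular on some neighbourhood of a given point.
\<close>

record ('k, 'a) vbundle =
  fibre :: "'k ppoint \<Rightarrow> ('a \<Rightarrow> 'k) set"
  regular_section_at :: "'k ppoint \<Rightarrow> ('k ppoint \<Rightarrow> 'a \<Rightarrow> 'k) \<Rightarrow> bool"

definition bundle_iso ::
  "'k::field ppoint set \<Rightarrow> ('k, 'a) vbundle \<Rightarrow> ('k, 'b) vbundle \<Rightarrow> bool" where
  "bundle_iso X E E' \<longleftrightarrow> (\<exists>\<phi> :: 'k ppoint \<Rightarrow> ('a \<Rightarrow> 'k) \<Rightarrow> ('b \<Rightarrow> 'k).
     (\<forall>x\<in>X. bij_betw (\<phi> x) (fibre E x) (fibre E' x) \<and>
        (\<forall>u\<in>fibre E x. \<forall>w\<in>fibre E x. \<phi> x (\<lambda>a. u a + w a) = (\<lambda>b. \<phi> x u b + \<phi> x w b)) \<and>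
        (\<forall>c. \<forall>u\<in>fibre E x. \<phi> x (\<lambda>a. c * u a) = (\<lambda>b. c * \<phi> x u b))) \<and>
     (\<forall>s. (\<forall>x\<in>X. s x \<in> fibre E x) \<longrightarrow>
        (\<forall>x\<in>X. regular_section_at E x s \<longleftrightarrow> regular_section_at E' x (\<lambda>y. \<phi> y (s y)))))"

text \<open>
  The pullback of a bundle along \<open>f\<close>, where \<open>f\<close> is defined on \<open>X\<close>: the fibre at \<open>x\<close> is the fibre
  of \<open>E\<close> at \<open>f x\<close>, and the regular sections are locally the linear combinations, with regular
  functions as coefficients, of pullbacks of regular sections of \<open>E\<close>.
\<close>

definition pullback ::
  "nat \<Rightarrow> 'k::field ppoint set \<Rightarrow> ('k ppoint \<Rightarrow> 'k ppoint) \<Rightarrow> ('k, 'a) vbundle \<Rightarrow> ('k, 'a) vbundle" where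
  "pullback n X f E = \<lparr>
     fibre = (\<lambda>x. fibre E (f x)),
     regular_section_at = (\<lambda>x s. \<exists>U (N::nat) h \<sigma>. openin (zariski_on n X) U \<and> x \<in> U \<and>
       (\<forall>i<N. \<forall>y\<in>U. regular_at n X y (h i) \<and> regular_section_at E (f y) (\<sigma> i)) \<and>
       (\<forall>y\<in>U. s y = (\<lambda>a. \<Sum>i<N. h i y * \<sigma> i (f y) a))) \<rparr>"

definition direct_sum ::
  "nat \<Rightarrow> 'k::field ppoint set \<Rightarrow> nat \<Rightarrow> (nat \<Rightarrow> ('k, 'a) vbundle) \<Rightarrow> ('k, nat \<times> 'a) vbundle" where
  "direct_sum n X N E = \<lparr>
     fibre = (\<lambda>x. {w. (\<forall>i<N. (\<lambda>a. w (i, a)) \<in> fibre (E i) x) \<and> (\<forall>i\<ge>N. \<forall>a. w (i, a) = 0)}),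
     regular_section_at = (\<lambda>x s.
       (\<forall>i<N. regular_section_at (E i) x (\<lambda>y a. s y (i, a))) \<and>
       (\<exists>U. openin (zariski_on n X) U \<and> x \<in> U \<and> (\<forall>y\<in>U. \<forall>i\<ge>N. \<forall>a. s y (i, a) = 0))) \<rparr>"

text \<open>
  The line bundle \<open>\<O>(a)\<close> on projective \<open>n\<close>-space.  Its fibre at \<open>x\<close> consists of the functions on
  the punctured line \<open>x\<close> that are homogeneous of degree \<open>a\<close>, extended by zero; its sections are
  locally quotients of forms whose degrees differ by \<open>a\<close>.
\<close>

definition twisting_bundle :: "nat \<Rightarrow> int \<Rightarrow> ('k::field, nat \<Rightarrow> 'k) vbundle" where
  "twisting_bundle n a = \<lparr>
     fibre = (\<lambda>x. {h. (\<forall>v\<in>x. \<forall>c. c \<noteq> 0 \<longrightarrow> h (\<lambda>i. c * v i) = c powi a * h v) \<and>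
                      (\<forall>v. v \<notin> x \<longrightarrow> h v = 0)}),
     regular_section_at = (\<lambda>x s. \<exists>U m l G H. openin (zariski n) U \<and> x \<in> U \<and>
       form n m G \<and> form n l H \<and> int m - int l = a \<and>
       (\<forall>y\<in>U. (\<forall>v\<in>y. H v \<noteq> 0) \<and> s y = (\<lambda>v. if v \<in> y then G v / H v else 0))) \<rparr>"

text \<open>
  Tangent vectors at \<open>x\<close> are the \<open>k\<close>-derivations from the local ring at \<open>x\<close> to \<open>k\<close>.  They are
  encoded as functionals on all functions, with value zero on functions not regular at \<open>x\<close>.
\<close>

definition tangent_space ::
  "nat \<Rightarrow> 'k::field ppoint set \<Rightarrow> 'k ppoint \<Rightarrow> (('k ppoint \<Rightarrow> 'k) \<Rightarrow> 'k) set" where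
  "tangent_space n X x = {D.
     (\<forall>g. \<not> regular_at n X x g \<longrightarrow> D g = 0) \<and>
     (\<forall>g h U. regular_at n X x g \<and> openin (zariski_on n X) U \<and> x \<in> U \<and> (\<forall>y\<in>U. g y = h y)
        \<longrightarrow> D g = D h) \<and>
     (\<forall>c g. regular_at n X x g \<longrightarrow> D (\<lambda>y. c * g y) = c * D g) \<and>
     (\<forall>g h. regular_at n X x g \<and> regular_at n X x h \<longrightarrow>
        D (\<lambda>y. g y + h y) = D g + D h \<and>
        D (\<lambda>y. g y * h y) = g x * D h + h x * D g)}"

text \<open>
  The tangent bundle of a smooth variety \<open>X\<close>; its sections are the vector fields that act on
  regular functions, i.e. the derivations of the structure sheaf.
\<close>

definition tangent_bundle ::
  "nat \<Rightarrow> 'k::field ppoint set \<Rightarrow> ('k, 'k ppoint \<Rightarrow> 'k) vbundle" where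
  "tangent_bundle n X = \<lparr>
     fibre = tangent_space n X,
     regular_section_at = (\<lambda>x s. \<exists>U. openin (zariski_on n X) U \<and> x \<in> U \<and>
       (\<forall>y\<in>U. s y \<in> tangent_space n X y \<and>
          (\<forall>g. regular_at n X y g \<longrightarrow> regular_at n X y (\<lambda>z. s z g)))) \<rparr>"

definition rational_curve ::
  "nat \<Rightarrow> 'k::field ppoint set \<Rightarrow> ('k ppoint \<Rightarrow> 'k ppoint) \<Rightarrow> bool" where
  "rational_curve n X f \<longleftrightarrow> variety_morphism 1 (proj_space 1) n X f"

text \<open>
  Every line bundle on the projective line is isomorphic to \<open>\<O>(e)\<close> for exactly one \<open>e\<close>, its degree.
\<close>

definition line_bundle_degree :: "('k::field, 'a) vbundle \<Rightarrow> int \<Rightarrow> bool" where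
  "line_bundle_degree L e \<longleftrightarrow> bundle_iso (proj_space 1) L (twisting_bundle 1 e)"

definition curve_degree :: "nat \<Rightarrow> ('k::field ppoint \<Rightarrow> 'k ppoint) \<Rightarrow> int \<Rightarrow> bool" where
  "curve_degree n f e \<longleftrightarrow>
     line_bundle_degree (pullback 1 (proj_space 1) f (twisting_bundle n 1)) e"

definition ample_on_P1 :: "('k::field, 'a) vbundle \<Rightarrow> bool" where
  "ample_on_P1 E \<longleftrightarrow> (\<exists>(N::nat) (a :: nat \<Rightarrow> int). (\<forall>i<N. a i > 0) \<and>
     bundle_iso (proj_space 1) E (direct_sum 1 (proj_space 1) N (\<lambda>i. twisting_bundle 1 (a i))))"

definition very_free ::
  "nat \<Rightarrow> 'k::field ppoint set \<Rightarrow> ('k ppoint \<Rightarrow> 'k ppoint) \<Rightarrow> bool" where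
  "very_free n X f \<longleftrightarrow> ample_on_P1 (pullback 1 (proj_space 1) f (tangent_bundle n X))"

definition fermat_hypersurface :: "nat \<Rightarrow> 'k::field ppoint set" where
  "fermat_hypersurface d = {x \<in> proj_space d. \<forall>v\<in>x. (\<Sum>i\<le>d. v i ^ d) = 0}"

end

theory Submission
  imports Defs
begin

text \<open>
  With \<open>q = p ^ r\<close>, there is no very free curve of degree \<open>e = q (q - 1)\<close> at all.  Such a curve is
  a tuple \<open>F\<close> of binary forms of degree \<open>e\<close> without common zero.  As the partial derivatives of
  the Fermat equation are \<open>q\<close>-th powers, tangent vectors along the curve are the \<open>w\<close> with
  \<open>\<Sum>F\<^sub>i\<^sup>q w\<^sub>i = 0\<close>, taken modulo \<open>F\<close>.  The quotient of the trivial bundle of rank \<open>d + 1\<close> by the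
  line \<open>F \<O>(- e)\<close>, twisted by \<open>- (q - 1)\<close>, has at least two independent sections by Riemann-Roch.
  The Frobenius twists of its sections are functionals on the \<open>w\<close>, and since the field is perfect
  some nonzero section has a twist vanishing on \<open>F\<close>.  This gives a nonzero homomorphism from the
  pulled back tangent bundle to \<open>\<O>\<close>.  But through any vector of an ample bundle at a finite point
  there is a global section vanishing at infinity; the homomorphism sends it to a global function
  vanishing at infinity, that is, to zero.
\<close>

section \<open>Univariate polynomials and linear systems\<close>

text \<open>The constants are forced by degree counts. The quotient bundle has rank
  \<open>q + 1\<close> and degree \<open>e\<close>, so after the twist by \<open>- (q - 1)\<close>
  its Euler characteristic is \<open>e - (q + 1) (q - 1) + (q + 1)\<close>, which is 2 for
  \<open>e = q (q - 1)\<close>. Tangent lifts \<open>w\<close> have components in O(e), and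
  Frobenius multiplies the twist by \<open>q\<close>, so the functional takes values in O(e - q (q -
  1)) = O. For the same reason its value on \<open>F\<close> is a single constant: one semilinear
  equation on a space of dimension at least two. The obstacle is that curves, bundles and tangent
  vectors are given only through points and germs. Global objects are therefore read off in the
  charts [1 : t] and [t : 1], where a function rational near every parameter is a polynomial and a
  section of O(a) is a pair of polynomials glued by \<open>t powi a\<close>. The final contradiction
  also needs actual derivations with a prescribed lift \<open>w\<close>; they exist because a form
  vanishing on the hypersurface near a point has zero derivative there in every tangent
  direction.\<close>

lemma homogeneous_system_nontrivial_solution:
  fixes a :: "'j \<Rightarrow> 'i \<Rightarrow> 'k::field"
  assumes "finite J" "finite I" "card J < card I"
  shows "\<exists>x. (\<exists>i\<in>I. x i \<noteq> 0) \<and> (\<forall>j\<in>J. (\<Sum>i\<in>I. a j i * x i) = 0)"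
  using assms
proof (induction J arbitrary: I a rule: finite_induct)
  case empty
  then have "I \<noteq> {}" by auto
  then show ?case by (intro exI[of _ "\<lambda>_. 1"]) auto
next
  case (insert j J)
  show ?case
  proof (cases "\<forall>i\<in>I. a j i = 0")
    case True
    from insert obtain x where "\<exists>i\<in>I. x i \<noteq> 0" "\<forall>j\<in>J. (\<Sum>i\<in>I. a j i * x i) = 0"
      by (metis card_insert_disjoint lessI less_trans)
    with True show ?thesis by (intro exI[of _ x]) auto
  next
    case False
    then obtain i0 where i0: "i0 \<in> I" "a j i0 \<noteq> 0" by blast
    \<comment> \<open>Solve equation \<open>j\<close> for the pivot unknown \<open>i0\<close> and
      substitute into the other equations; \<open>y\<close> restores the pivot at the end.\<close>
    define I' where "I' = I - {i0}"
    have I: "I = insert i0 I'" "i0 \<notin> I'" "finite I'"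
      using i0 insert.prems by (auto simp: I'_def)
    have "card J < card I'" using insert I by simp
    from insert.IH[OF \<open>finite I'\<close> this, of "\<lambda>j' i. a j' i - a j' i0 * a j i / a j i0"]
    obtain x where x: "\<exists>i\<in>I'. x i \<noteq> 0"
      "\<And>j'. j' \<in> J \<Longrightarrow> (\<Sum>i\<in>I'. (a j' i - a j' i0 * a j i / a j i0) * x i) = 0" by blast
    define s where "s = (\<Sum>i\<in>I'. a j i * x i)"
    define y where "y = x(i0 := - s / a j i0)"
    have y: "(\<Sum>i\<in>I. a j' i * y i) = (\<Sum>i\<in>I'. a j' i * x i) - a j' i0 * s / a j i0" for j'
    proof -
      have "(\<Sum>i\<in>I'. a j' i * y i) = (\<Sum>i\<in>I'. a j' i * x i)"
        by (rule sum.cong) (use I in \<open>auto simp: y_def\<close>)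
      then show ?thesis using I by (simp add: y_def)
    qed
    have "(\<Sum>i\<in>I. a j' i * y i) = 0" if "j' \<in> insert j J" for j'
    proof (cases "j' = j")
      case True then show ?thesis using i0 y[of j] by (simp add: s_def)
    next
      case False
      with that have "j' \<in> J" by simp
      have "(\<Sum>i\<in>I'. (a j' i - a j' i0 * a j i / a j i0) * x i) =
          (\<Sum>i\<in>I'. a j' i * x i) - (a j' i0 / a j i0) * s"
        unfolding s_def sum_distrib_left
        by (simp add: sum_subtractf[symmetric] algebra_simps)
      then show ?thesis using x(2)[OF \<open>j' \<in> J\<close>] y[of j'] by simp
    qed
    moreover have "\<exists>i\<in>I. y i \<noteq> 0" using x(1) I by (auto simp: y_def)
    ultimately show ?thesis by blast
  qed
qed

text \<open>Roots are split off one at a time. A simple root \<open>a\<close> of \<open>F\<close> is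
  not a root of the cofactor \<open>F'\<close>, so at every root \<open>b\<close> of
  \<open>F'\<close> the factor \<open>b - a\<close> is invertible and the cofactor of
  \<open>R\<close> inherits the vanishing.\<close>

lemma simple_roots_imp_dvd:
  fixes F R :: "'k::alg_closed_field poly"
  assumes "F \<noteq> 0" "\<And>a. \<not> (poly F a = 0 \<and> poly (pderiv F) a = 0)"
    and "\<And>a. poly F a = 0 \<Longrightarrow> poly R a = 0"
  shows "F dvd R"
  using assms
proof (induction "degree F" arbitrary: F R)
  case 0
  then show ?case by (metis degree_eq_zeroE dvd_trans is_unit_const_poly_iff is_unit_iff_degree one_dvd)
next
  case (Suc n)
  then obtain a where a: "poly F a = 0" by (metis alg_closed_imp_poly_has_root zero_less_Suc)
  then obtain F' where F: "F = [:-a, 1:] * F'" by (metis dvdE poly_eq_0_iff_dvd)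
  from a Suc obtain R' where R: "R = [:-a, 1:] * R'" by (metis dvdE poly_eq_0_iff_dvd)
  have nz: "F' \<noteq> 0" using Suc F by auto
  have "degree F = Suc (degree F')" unfolding F using nz by (subst degree_mult_eq) auto
  then have d: "n = degree F'" using Suc by simp
  have pd: "poly (pderiv F) b = (b - a) * poly (pderiv F') b + poly F' b" for b
    unfolding F pderiv_mult by (simp add: pderiv_pCons algebra_simps)
  have "F' dvd R'"
  proof (rule Suc.hyps(1)[OF d nz])
    show "\<not> (poly F' b = 0 \<and> poly (pderiv F') b = 0)" for b
      using Suc.prems(2)[of b] pd[of b] F by auto
    show "poly R' b = 0" if "poly F' b = 0" for b
    proof -
      have "b \<noteq> a" using Suc.prems(2)[of a] pd[of a] a that by auto
      moreover have "poly R b = 0" using that F Suc.prems(3)[of b] by simp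
      ultimately show ?thesis by (simp add: R)
    qed
  qed
  then show ?case unfolding F R by (intro mult_dvd_mono dvd_refl)
qed

lemma infinite_UNIV_alg_closed: "infinite (UNIV :: 'k::alg_closed_field set)"
proof
  assume fin: "finite (UNIV :: 'k set)"
  define P :: "'k poly" where "P = (\<Prod>a\<in>UNIV. [:-a, 1:])"
  have Pz: "poly P x = 0" for x
    unfolding P_def poly_prod using fin by (auto intro!: exI[of _ x])
  have "degree P = card (UNIV :: 'k set)"
    unfolding P_def by (subst degree_prod_sum_eq) auto
  \<comment> \<open>\<open>P\<close> vanishes at every element of the field, so \<open>P + 1\<close>
    is a nonconstant polynomial without a root.\<close>
  then have "degree (P + 1) > 0" using fin by (simp add: degree_add_eq_left card_gt_0_iff)
  then obtain x where "poly (P + 1) x = 0" using alg_closed_imp_poly_has_root by blast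
  then show False using Pz by simp
qed

lemma poly_eqI_cofinite:
  fixes P Q :: "'k::alg_closed_field poly"
  assumes "finite {t. poly P t \<noteq> poly Q t}"
  shows "P = Q"
proof (rule ccontr)
  assume "P \<noteq> Q"
  then have "finite {t. poly (P - Q) t = 0}" by (intro poly_roots_finite) auto
  then have "finite ({t. poly P t \<noteq> poly Q t} \<union> {t. poly (P - Q) t = 0})" using assms by simp
  moreover have "\<dots> = UNIV" by auto
  ultimately show False using infinite_UNIV_alg_closed by metis
qed

section \<open>Functions of one parameter that are locally quotients of polynomials\<close>

text \<open>The denominator \<open>Q\<close> also cuts out the neighbourhood on which the quotient
  is valid, so no open sets have to be carried along.\<close>

definition rational_at :: "'k::field \<Rightarrow> ('k \<Rightarrow> 'k) \<Rightarrow> bool" where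
  "rational_at t0 a \<longleftrightarrow> (\<exists>P Q. poly Q t0 \<noteq> 0 \<and> (\<forall>t. poly Q t \<noteq> 0 \<longrightarrow> a t * poly Q t = poly P t))"

text \<open>A further restriction \<open>L\<close> of the neighbourhood is absorbed by multiplying
  numerator and denominator by it.\<close>

lemma rational_atI:
  assumes "poly L t0 \<noteq> 0" "poly Q t0 \<noteq> 0"
    and "\<And>t. poly L t \<noteq> 0 \<Longrightarrow> poly Q t \<noteq> 0 \<Longrightarrow> a t * poly Q t = poly P t"
  shows "rational_at t0 a"
  unfolding rational_at_def
  by (rule exI[of _ "P * L"], rule exI[of _ "Q * L"]) (use assms in \<open>auto simp flip: mult.assoc\<close>)

lemma rational_at_cong:
  assumes "rational_at t0 a" "poly L t0 \<noteq> 0" "\<And>t. poly L t \<noteq> 0 \<Longrightarrow> a t = b t"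
  shows "rational_at t0 b"
proof -
  from assms(1) obtain P Q where "poly Q t0 \<noteq> 0" "\<forall>t. poly Q t \<noteq> 0 \<longrightarrow> a t * poly Q t = poly P t"
    unfolding rational_at_def by blast
  with assms(2,3) show ?thesis by (intro rational_atI[of L t0 Q b P]) auto
qed

lemma rational_at_poly: "rational_at t0 (poly P)"
  by (rule rational_atI[of 1 _ 1 _ P]) auto

lemma rational_at_add:
  assumes "rational_at t0 a" "rational_at t0 b"
  shows "rational_at t0 (\<lambda>t. a t + b t)"
proof -
  from assms obtain P Q P' Q' where *: "poly Q t0 \<noteq> 0" "\<forall>t. poly Q t \<noteq> 0 \<longrightarrow> a t * poly Q t = poly P t"
    "poly Q' t0 \<noteq> 0" "\<forall>t. poly Q' t \<noteq> 0 \<longrightarrow> b t * poly Q' t = poly P' t"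
    unfolding rational_at_def by blast
  show ?thesis
  proof (rule rational_atI[of 1 _ "Q * Q'" _ "P * Q' + P' * Q"])
    fix t assume "poly (Q * Q') t \<noteq> 0"
    then have "a t * poly Q t = poly P t" "b t * poly Q' t = poly P' t" using * by auto
    then show "(a t + b t) * poly (Q * Q') t = poly (P * Q' + P' * Q) t"
      by (simp add: algebra_simps)
  qed (use * in auto)
qed

lemma rational_at_mult:
  assumes "rational_at t0 a" "rational_at t0 b"
  shows "rational_at t0 (\<lambda>t. a t * b t)"
proof -
  from assms obtain P Q P' Q' where *: "poly Q t0 \<noteq> 0" "\<forall>t. poly Q t \<noteq> 0 \<longrightarrow> a t * poly Q t = poly P t"
    "poly Q' t0 \<noteq> 0" "\<forall>t. poly Q' t \<noteq> 0 \<longrightarrow> b t * poly Q' t = poly P' t"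
    unfolding rational_at_def by blast
  show ?thesis
  proof (rule rational_atI[of 1 _ "Q * Q'" _ "P * P'"])
    fix t assume "poly (Q * Q') t \<noteq> 0"
    then have "a t * poly Q t = poly P t" "b t * poly Q' t = poly P' t" using * by auto
    then show "(a t * b t) * poly (Q * Q') t = poly (P * P') t"
      by simp (metis mult.assoc mult.commute)
  qed (use * in auto)
qed

lemma rational_at_sum:
  assumes "\<And>i. i \<in> I \<Longrightarrow> rational_at t0 (a i)"
  shows "rational_at t0 (\<lambda>t. \<Sum>i\<in>I. a i t)"
  using assms
proof (induction I rule: infinite_finite_induct)
  case (insert i I)
  then show ?case using rational_at_add[of t0 "a i"] by simp
qed (use rational_at_poly[of t0 0] in \<open>simp_all add: poly_0[abs_def]\<close>)

text \<open>A denominator of least degree cannot vanish anywhere, hence is constant.\<close>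

lemma rational_everywhere_imp_poly:
  fixes a :: "'k::alg_closed_field \<Rightarrow> 'k"
  assumes "\<And>t0. rational_at t0 a"
  obtains P where "\<And>t. a t = poly P t"
proof -
  \<comment> \<open>Equality is demanded only off a finite set, so that cancelling a common linear
    factor does not leave \<open>S\<close>.\<close>
  define S where "S Q P \<longleftrightarrow> Q \<noteq> 0 \<and> finite {t. a t * poly Q t \<noteq> poly P t}" for Q P :: "'k poly"
  have ex: "\<exists>P Q. S Q P \<and> poly Q t0 \<noteq> 0 \<and> a t0 * poly Q t0 = poly P t0" for t0
  proof -
    from assms[of t0] obtain P Q where PQ: "poly Q t0 \<noteq> 0"
      "\<forall>t. poly Q t \<noteq> 0 \<longrightarrow> a t * poly Q t = poly P t"
      unfolding rational_at_def by blast
    then have "Q \<noteq> 0" by auto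
    moreover have "finite {t. a t * poly Q t \<noteq> poly P t}"
      by (rule finite_subset[OF _ poly_roots_finite[OF \<open>Q \<noteq> 0\<close>]]) (use PQ in auto)
    ultimately show ?thesis using PQ by (auto simp: S_def)
  qed
  define n where "n = (LEAST n. \<exists>Q P. S Q P \<and> degree Q = n)"
  have "\<exists>n Q P. S Q P \<and> degree Q = n" using ex by blast
  then have "\<exists>Q P. S Q P \<and> degree Q = n" unfolding n_def by (rule LeastI_ex)
  then obtain Q P where Q: "S Q P" "degree Q = n" by blast
  have min: "n \<le> degree Q'" if "S Q' P'" for Q' P'
    unfolding n_def by (rule Least_le) (use that in blast)
  have cross: "P * Q' = P' * Q" if "S Q' P'" for Q' P'
  proof (rule poly_eqI_cofinite, rule finite_subset)
    show "finite ({t. a t * poly Q t \<noteq> poly P t} \<union> {t. a t * poly Q' t \<noteq> poly P' t})"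
      using Q that by (auto simp: S_def)
    show "{t. poly (P * Q') t \<noteq> poly (P' * Q) t} \<subseteq>
        {t. a t * poly Q t \<noteq> poly P t} \<union> {t. a t * poly Q' t \<noteq> poly P' t}"
    proof (rule subsetI, rule ccontr)
      fix t assume "t \<in> {t. poly (P * Q') t \<noteq> poly (P' * Q) t}"
        and "t \<notin> {t. a t * poly Q t \<noteq> poly P t} \<union> {t. a t * poly Q' t \<noteq> poly P' t}"
      moreover from this have "poly P t = a t * poly Q t" "poly P' t = a t * poly Q' t" by auto
      ultimately show False by simp
    qed
  qed
  have "n = 0"
  proof (rule ccontr)
    assume "n \<noteq> 0"
    then obtain t1 where t1: "poly Q t1 = 0" using Q alg_closed_imp_poly_has_root[of Q] by auto
    \<comment> \<open>Comparison with a fraction whose denominator is nonzero at \<open>t1\<close>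
      forces \<open>P\<close> to vanish there too; cancelling \<open>t - t1\<close> then contradicts
      minimality.\<close>
    obtain P' Q' where P': "S Q' P'" "poly Q' t1 \<noteq> 0" using ex by blast
    have "poly (P * Q') t1 = poly (P' * Q) t1" using cross[OF P'(1)] by simp
    then have "poly P t1 = 0" using t1 P' by simp
    then obtain P2 where P2: "P = [:-t1, 1:] * P2" by (metis dvdE poly_eq_0_iff_dvd)
    from t1 obtain Q2 where Q2: "Q = [:-t1, 1:] * Q2" by (metis dvdE poly_eq_0_iff_dvd)
    have nz: "Q2 \<noteq> 0" using Q Q2 by (auto simp: S_def)
    have "finite {t. a t * poly Q2 t \<noteq> poly P2 t}"
    proof (rule finite_subset)
      show "finite (insert t1 {t. a t * poly Q t \<noteq> poly P t})" using Q by (simp add: S_def)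
      show "{t. a t * poly Q2 t \<noteq> poly P2 t} \<subseteq> insert t1 {t. a t * poly Q t \<noteq> poly P t}"
      proof
        fix t assume t: "t \<in> {t. a t * poly Q2 t \<noteq> poly P2 t}"
        have "a t * poly Q t - poly P t = (t - t1) * (a t * poly Q2 t - poly P2 t)"
          by (simp add: P2 Q2 algebra_simps)
        with t show "t \<in> insert t1 {t. a t * poly Q t \<noteq> poly P t}" by auto
      qed
    qed
    then have "S Q2 P2" using nz by (simp add: S_def)
    then have "n \<le> degree Q2" by (rule min)
    moreover have "degree Q = Suc (degree Q2)"
      unfolding Q2 using nz by (subst degree_mult_eq) auto
    ultimately show False using Q by simp
  qed
  then obtain c where c: "Q = [:c:]" using Q by (metis degree_eq_zeroE)
  then have "c \<noteq> 0" using Q by (auto simp: S_def)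
  \<comment> \<open>\<open>S\<close> ignores finitely many parameters, so the value at each
    \<open>t\<close> is recovered from a fraction that is valid at \<open>t\<close> itself.\<close>
  have "a t = poly (smult (inverse c) P) t" for t
  proof -
    obtain P' Q' where P': "S Q' P'" "poly Q' t \<noteq> 0" "a t * poly Q' t = poly P' t" using ex by blast
    have "poly (P * Q') t = poly (P' * Q) t" using cross[OF P'(1)] by simp
    then show ?thesis using P' c \<open>c \<noteq> 0\<close> by (simp add: field_simps) (metis P'(3) mult.assoc mult.commute mult_cancel_right)
  qed
  then show ?thesis using that by blast
qed

text \<open>\<open>R\<close> is the same section of O(e) in the coordinate \<open>1 / t\<close> at
  infinity: a pole of order at most \<open>e\<close> bounds the degree, and a nonzero value at
  infinity is the coefficient of \<open>t ^ e\<close>.\<close>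

lemma degree_le_if_reversible:
  fixes P R :: "'k::alg_closed_field poly"
  assumes "\<And>t. t \<noteq> 0 \<Longrightarrow> poly P t = t ^ e * poly R (inverse t)"
  shows "degree P \<le> e" and "poly R 0 \<noteq> 0 \<Longrightarrow> degree P = e"
proof -
  have eq: "monom 1 (degree R) * P = monom 1 e * reflect_poly R"
  proof (rule poly_eqI_cofinite, rule finite_subset)
    show "{t. poly (monom 1 (degree R) * P) t \<noteq> poly (monom 1 e * reflect_poly R) t} \<subseteq> {0}"
    proof
      fix t assume t: "t \<in> {t. poly (monom 1 (degree R) * P) t \<noteq> poly (monom 1 e * reflect_poly R) t}"
      show "t \<in> {0}"
      proof (rule ccontr)
        assume "t \<notin> {0}"
        then show False using t assms[of t] by (simp add: poly_monom poly_reflect_poly_nz)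
      qed
    qed
  qed simp
  show "degree P \<le> e"
  proof (cases "P = 0 \<or> R = 0")
    case True
    then have "P = 0" using eq by auto
    then show ?thesis by simp
  next
    case False
    then have "degree R + degree P = e + degree (reflect_poly R)"
      using arg_cong[OF eq, of degree] by (simp add: degree_mult_eq degree_monom_eq)
    then show ?thesis using degree_reflect_poly_le[of R] by simp
  qed
  assume "poly R 0 \<noteq> 0"
  then have R: "coeff R 0 \<noteq> 0" "R \<noteq> 0" by (auto simp: poly_0_coeff_0)
  then have "P \<noteq> 0" using eq by auto
  then have "degree R + degree P = e + degree (reflect_poly R)"
    using arg_cong[OF eq, of degree] R by (simp add: degree_mult_eq degree_monom_eq)
  then show "degree P = e" using R by simp
qed

lemma reversal_exists:
  fixes P :: "'k::field poly"
  assumes "degree P \<le> e"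
  obtains R where "\<And>z. z \<noteq> 0 \<Longrightarrow> poly R z = z ^ e * poly P (inverse z)"
proof
  fix z :: 'k assume "z \<noteq> 0"
  \<comment> \<open>\<open>reflect_poly\<close> reverses with respect to the actual degree; the
    monomial makes up the difference to \<open>e\<close>.\<close>
  then show "poly (monom 1 (e - degree P) * reflect_poly P) z = z ^ e * poly P (inverse z)"
    using assms by (simp add: poly_monom poly_reflect_poly_nz flip: mult.assoc power_add)
qed

section \<open>A Frobenius-twisted cotangent section\<close>

text \<open>
  \<open>G\<close> lives in the inverse system of negative Laurent forms, of dimension \<open>q\<^sup>2 - 2\<close>; requiring that
  the coefficients of \<open>G F\<^sub>i\<close> in degrees \<open>e + 1, \<dots>, e + m - 1\<close> vanish imposes \<open>q\<^sup>2 - 4\<close> conditions.  The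
  Frobenius-semilinear obstruction \<open>\<Sum>A\<^sub>i\<^sup>q F\<^sub>i\<close> is a constant, so it can be killed on the remaining
  two-dimensional space.
\<close>

lemma frobenius_cotangent_section:
  fixes F :: "nat \<Rightarrow> 'k::alg_closed_field poly" and q r e m d :: nat
  assumes q: "q = CHAR('k) ^ r" "prime CHAR('k)" "q \<ge> 2"
    and m: "m = q - 1" and e: "e = q * (q - 1)" and d: "d = q + 1"
    and deg: "\<And>i. i \<le> d \<Longrightarrow> degree (F i) \<le> e"
    and nz: "\<And>t. \<exists>i\<le>d. poly (F i) t \<noteq> 0"
    and inf: "\<exists>i\<le>d. degree (F i) = e"
    and fermat: "(\<Sum>i\<le>d. F i ^ (q + 1)) = 0"
  obtains G A B where
    "\<And>i. i \<le> d \<Longrightarrow> G * F i = monom 1 (m + e) * A i + B i"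
    "\<And>i. i \<le> d \<Longrightarrow> degree (B i) \<le> e"
    "(\<Sum>i\<le>d. A i ^ q * F i) = 0" "(\<Sum>i\<le>d. B i ^ q * F i) = 0"
    "\<exists>i\<le>d. \<exists>j\<le>d. A i * F j \<noteq> A j * F i"
proof -
  obtain s where s: "q = s + 2" using q(3) by (metis add.commute le_iff_add)
  \<comment> \<open>This is \<open>q * m = e\<close> in disguise; it makes the degrees in
    \<open>KB\<close> match, which forces \<open>K\<close> to be constant.\<close>
  have me: "q * (m + e) = q * e + e" and mpos: "m > 0"
    using s by (auto simp: m e algebra_simps)
  \<comment> \<open>\<open>G / t ^ (m + e)\<close> is a Cech cocycle for O(- m - e). The exponents 1
    to \<open>m + e - 1\<close> in \<open>G\<close> form a basis of the first cohomology; exponent 0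
    and exponents from \<open>m + e\<close> on give coboundaries.\<close>
  define N where "N = m + e - 1"
  have frob: "(x + y) ^ q = x ^ q + y ^ q" for x y :: "'k poly"
    unfolding q(1) using freshmans_dream'[where ?'a="'k poly" and x=x and y=y and n=r] q(2) by simp
  define G :: "(nat \<Rightarrow> 'k) \<Rightarrow> 'k poly" where "G x = (\<Sum>b\<in>{1..N}. monom (x b) b)" for x
  \<comment> \<open>\<open>G F i / t ^ (m + e)\<close> is cut into \<open>A\<close>, regular at
    finite parameters, and \<open>B / t ^ (m + e)\<close>, regular at infinity as a section of O(-
    m). The coefficients in between are the obstruction that \<open>sol\<close> sets to
    zero.\<close>
  define A where "A x i = poly_shift (m + e) (G x * F i)" for x i
  define B where "B x i = poly_cutoff (e + 1) (G x * F i)" for x i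
  define K where "K x = (\<Sum>i\<le>d. A x i ^ q * F i)" for x
  define sol where "sol x \<longleftrightarrow> (\<forall>i\<le>d. \<forall>k\<in>{e+1..<e+m}. coeff (G x * F i) k = 0)" for x
  define a where "a j b = (case j of (i, k) \<Rightarrow> if k < b then 0 else coeff (F i) (k - b))" for j and b :: nat
  define J where "J = {..d} \<times> {e+1..<e+m}"
  have coeff_GF: "coeff (G x * F i) k = (\<Sum>b\<in>{1..N}. a (i, k) b * x b)" for x i k
    unfolding G_def sum_distrib_right coeff_sum a_def
    by (intro sum.cong) (auto simp: coeff_monom_mult)
  have G_coeff: "coeff (G x) b = (if b \<in> {1..N} then x b else 0)" for x b
    unfolding G_def coeff_sum by (simp add: sum.delta)
  have sol_iff: "sol x \<longleftrightarrow> (\<forall>j\<in>J. (\<Sum>b\<in>{1..N}. a j b * x b) = 0)" for x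
    unfolding sol_def J_def coeff_GF by auto
  have finJ: "finite J" by (simp add: J_def)
  have cardJ: "card J + 2 = N"
    unfolding J_def N_def by (simp add: s m e d algebra_simps)
  have split: "G x * F i = monom 1 (m + e) * A x i + B x i" if "sol x" "i \<le> d" for x i
    using that mpos
    by (intro poly_eqI)
      (auto simp: A_def B_def coeff_monom_mult coeff_poly_shift coeff_poly_cutoff sol_def)
  have degB: "degree (B x i) \<le> e" for x i
    by (rule degree_le) (simp add: B_def coeff_poly_cutoff)
  \<comment> \<open>The \<open>q\<close>-th power of the splitting is additive, and the Fermat
    equation kills the sum of the \<open>G ^ q F ^ (q + 1)\<close>; so the obstructions computed in
    the two charts agree up to sign.\<close>
  have KB: "monom 1 (q * (m + e)) * K x = - (\<Sum>i\<le>d. B x i ^ q * F i)" if "sol x" for x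
  proof -
    have "monom 1 (q * (m + e)) * K x + (\<Sum>i\<le>d. B x i ^ q * F i)
        = (\<Sum>i\<le>d. (monom 1 (m + e) * A x i + B x i) ^ q * F i)"
      unfolding K_def frob
      by (simp add: sum_distrib_left sum.distrib algebra_simps power_mult_distrib monom_power)
    also have "\<dots> = (\<Sum>i\<le>d. G x ^ q * F i ^ (q + 1))"
    proof (intro sum.cong refl)
      fix i assume "i \<in> {..d}"
      then have "(monom 1 (m + e) * A x i + B x i) ^ q = (G x * F i) ^ q"
        using split[OF that] by simp
      then show "(monom 1 (m + e) * A x i + B x i) ^ q * F i = G x ^ q * F i ^ (q + 1)"
        by (simp add: power_mult_distrib)
    qed
    also have "\<dots> = 0" unfolding sum_distrib_left[symmetric] fermat by simp
    finally show ?thesis by (simp add: eq_neg_iff_add_eq_0)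
  qed
  have degK: "degree (K x) = 0" if "sol x" for x
  proof (cases "K x = 0")
    case False
    from KB[OF that] have "degree (monom 1 (q * (m + e)) * K x) = degree (\<Sum>i\<le>d. B x i ^ q * F i)"
      by simp
    also have "\<dots> \<le> q * e + e"
    proof (rule degree_sum_le)
      fix i assume "i \<in> {..d}"
      have "degree (B x i ^ q * F i) \<le> degree (B x i) * q + degree (F i)"
        by (rule order.trans[OF degree_mult_le]) (simp add: degree_power_le)
      also have "\<dots> \<le> e * q + e" using degB[of x i] deg[of i] \<open>i \<in> {..d}\<close>
        by (intro add_mono mult_right_mono) auto
      finally show "degree (B x i ^ q * F i) \<le> q * e + e" by (simp add: mult.commute)
    qed simp
    finally show ?thesis using False me by (simp add: degree_mult_eq degree_monom_eq)
  qed simp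
  obtain x1 where x1: "\<exists>b\<in>{1..N}. x1 b \<noteq> 0" "sol x1"
    using homogeneous_system_nontrivial_solution[of J "{1..N}" a] cardJ finJ sol_iff by auto
  then obtain b1 where b1: "b1 \<in> {1..N}" "x1 b1 \<noteq> 0" by blast
  \<comment> \<open>The equation indexed by \<open>None\<close> sets the unknown \<open>b1\<close>
    to zero. There are two more unknowns than equations in \<open>J\<close>, so a nonzero solution
    survives, and it is independent of \<open>x1\<close>.\<close>
  define a' where "a' j b = (case j of None \<Rightarrow> (if b = b1 then 1 else 0) | Some j \<Rightarrow> a j b)" for j b
  have "card (insert None (Some ` J)) < card {1..N}"
    using cardJ finJ by (simp add: card_image)
  then obtain x2 where x2: "\<exists>b\<in>{1..N}. x2 b \<noteq> 0"
    "\<forall>j\<in>insert None (Some ` J). (\<Sum>b\<in>{1..N}. a' j b * x2 b) = 0"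
    using homogeneous_system_nontrivial_solution[of "insert None (Some ` J)" "{1..N}" a'] finJ
    by auto
  have "sol x2" unfolding sol_iff using x2(2) by (auto simp: a'_def)
  have "(\<Sum>b\<in>{1..N}. (if b = b1 then 1 else 0) * x2 b) = 0"
    using x2(2) unfolding a'_def by auto
  moreover have "(\<Sum>b\<in>{1..N}. (if b = b1 then 1 else 0) * x2 b) = (\<Sum>b\<in>{1..N}. if b = b1 then x2 b else 0)"
    by (intro sum.cong) auto
  ultimately have "x2 b1 = 0" using b1 by simp
  have "\<exists>x. sol x \<and> K x = 0 \<and> G x \<noteq> 0"
  proof (cases "K x1 = 0")
    case True
    have "coeff (G x1) b1 \<noteq> 0" using b1 G_coeff by simp
    then have "G x1 \<noteq> 0" by auto
    then show ?thesis using True x1 by blast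
  next
    case False
    obtain k1 where k1: "K x1 = [:k1:]" using degK[OF x1(2)] by (metis degree_eq_zeroE)
    obtain k2 where k2: "K x2 = [:k2:]" using degK[OF \<open>sol x2\<close>] by (metis degree_eq_zeroE)
    \<comment> \<open>\<open>K\<close> is additive and scaling by \<open>c\<close> multiplies it by
      \<open>c ^ q\<close>, so a \<open>q\<close>-th root cancels the value at \<open>x2\<close>
      against that at \<open>x1\<close>.\<close>
    obtain c where c: "c ^ q = - k2 / k1" using nth_root_exists[of q "- k2 / k1"] s by auto
    define x where "x b = x2 b + c * x1 b" for b
    have G: "G x = G x2 + smult c (G x1)"
      by (rule poly_eqI) (simp add: G_coeff x_def)
    have A: "A x i = A x2 i + smult c (A x1 i)" for i
      by (rule poly_eqI) (simp add: A_def coeff_poly_shift G algebra_simps)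
    have "A x i ^ q * F i = A x2 i ^ q * F i + [:c ^ q:] * (A x1 i ^ q * F i)" for i
      by (simp add: A frob smult_power[symmetric] algebra_simps)
    then have "K x = K x2 + [:c ^ q:] * K x1"
      by (simp only: K_def sum.distrib sum_distrib_left)
    also have "\<dots> = 0" using c k1 k2 False by simp
    finally have "K x = 0" .
    moreover have "sol x"
      unfolding sol_def
      using x1(2) \<open>sol x2\<close> by (auto simp: sol_def G algebra_simps)
    moreover have "G x \<noteq> 0"
    proof
      assume "G x = 0"
      then have z: "x b = 0" if "b \<in> {1..N}" for b using G_coeff[of x b] that by simp
      from z[OF b1(1)] have "c = 0" using \<open>x2 b1 = 0\<close> b1 by (simp add: x_def)
      with z x2(1) show False by (auto simp: x_def)
    qed
    ultimately show ?thesis by blast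
  qed
  then obtain x where x: "sol x" "K x = 0" "G x \<noteq> 0" by blast
  \<comment> \<open>If \<open>A\<close> were proportional to \<open>F\<close>, the section of the
    quotient bundle would be zero and the class of \<open>G\<close> trivial, although
    \<open>G x\<close> is a nonzero combination of basis classes.\<close>
  have "\<exists>i\<le>d. \<exists>j\<le>d. A x i * F j \<noteq> A x j * F i"
  proof (rule ccontr)
    assume "\<not> ?thesis"
    then have cross: "A x i * F j = A x j * F i" if "i \<le> d" "j \<le> d" for i j using that by blast
    obtain i where i: "\<And>t. i t \<le> d \<and> poly (F (i t)) t \<noteq> 0" using nz by metis
    define \<rho> where "\<rho> t = poly (A x (i t)) t / poly (F (i t)) t" for t
    have \<rho>: "\<rho> t * poly (F j) t = poly (A x j) t" if "j \<le> d" for t j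
      using arg_cong[OF cross[OF that, of "i t"], of "\<lambda>p. poly p t"] i[of t]
      by (simp add: \<rho>_def field_simps)
    have "rational_at t0 \<rho>" for t0
      unfolding rational_at_def using i[of t0] \<rho> by blast
    then obtain P where P: "\<And>t. \<rho> t = poly P t"
      by (rule rational_everywhere_imp_poly) blast
    have AP: "A x j = P * F j" if "j \<le> d" for j
      by (rule poly_eqI_cofinite) (simp add: \<rho>[OF that, symmetric] P)
    obtain j where j: "j \<le> d" "degree (F j) = e" using inf by blast
    have "e > 0" using s by (simp add: e)
    then have "F j \<noteq> 0" using j by auto
    \<comment> \<open>Since \<open>C F j = B j\<close> has degree at most \<open>e\<close>,
      \<open>C\<close> is constant; since the exponents in \<open>G\<close> start at 1, its constant
      term is zero.\<close>
    define C where "C = G x - monom 1 (m + e) * P"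
    have "C * F j = B x j"
      unfolding C_def using split[OF x(1) j(1)] AP[OF j(1)] by (simp add: algebra_simps)
    have "C = 0"
    proof (rule ccontr)
      assume "C \<noteq> 0"
      then have "degree C + e = degree (B x j)"
        using \<open>F j \<noteq> 0\<close> j \<open>C * F j = B x j\<close> by (metis degree_mult_eq)
      then have "degree C = 0" using degB[of x j] by simp
      moreover have "coeff C 0 = 0"
        using mpos by (simp add: C_def G_coeff coeff_monom_mult)
      ultimately show False using \<open>C \<noteq> 0\<close> by (metis leading_coeff_0_iff)
    qed
    then have "G x = monom 1 (m + e) * P" by (simp add: C_def)
    moreover from this x(3) have "P \<noteq> 0" by auto
    ultimately have "degree (G x) \<ge> m + e" by (simp add: degree_mult_eq degree_monom_eq)
    moreover have "degree (G x) \<le> N" by (rule degree_le) (simp add: G_coeff)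
    ultimately show False using mpos by (simp add: N_def)
  qed
  then show ?thesis using that[of "G x" "A x" "B x"] split[OF x(1)] degB x(2) KB[OF x(1)]
    by (simp add: K_def)
qed

section \<open>Forms and the Zariski topology\<close>

text \<open>Sums and products of forms produce the same exponent vector several times, whereas
  \<open>form\<close> sums over a set of exponents; the coefficients of equal exponents are
  collected.\<close>

lemma form_from_family:
  fixes F :: "(nat \<Rightarrow> 'k::field) \<Rightarrow> 'k"
  assumes "finite K" "\<And>k. k \<in> K \<Longrightarrow> (\<Sum>i\<le>n. \<alpha> k i) = m"
    and "F = (\<lambda>v. \<Sum>k\<in>K. c k * (\<Prod>i\<le>n. v i ^ \<alpha> k i))"
  shows "form n m F"
proof -
  have "(\<Sum>k\<in>K. c k * (\<Prod>i\<le>n. v i ^ \<alpha> k i))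
      = (\<Sum>\<beta>\<in>\<alpha> ` K. (\<Sum>k\<in>{k \<in> K. \<alpha> k = \<beta>}. c k) * (\<Prod>i\<le>n. v i ^ \<beta> i))" for v :: "nat \<Rightarrow> 'k"
    by (subst sum.image_gen[OF assms(1), of _ \<alpha>]) (simp add: sum_distrib_right)
  then show ?thesis unfolding form_def assms(3) using assms(1,2)
    by (intro exI[of _ "\<alpha> ` K"] exI[of _ "\<lambda>\<beta>. \<Sum>k\<in>{k \<in> K. \<alpha> k = \<beta>}. c k"]) auto
qed

lemma form_coord:
  assumes "i \<le> n"
  shows "form n 1 (\<lambda>v :: nat \<Rightarrow> 'k::field. v i)"
proof (rule form_from_family)
  show "(\<Sum>j\<le>n. (if j = i then 1 else 0)) = (1::nat)" using assms by simp
  have "(\<Prod>j\<le>n. v j ^ (if j = i then 1 else 0)) = v i" for v :: "nat \<Rightarrow> 'k"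
  proof -
    have "(\<Prod>j\<le>n. v j ^ (if j = i then 1 else 0)) = (\<Prod>j\<le>n. if j = i then v j else 1)"
      by (intro prod.cong) auto
    then show ?thesis using assms by simp
  qed
  then show "(\<lambda>v :: nat \<Rightarrow> 'k. v i)
      = (\<lambda>v. \<Sum>k\<in>{()}. 1 * (\<Prod>j\<le>n. v j ^ (if j = i then 1 else 0)))" by simp
qed simp

lemma form_const: "form n 0 (\<lambda>v. c)"
  by (rule form_from_family[where K = "{()}" and \<alpha> = "\<lambda>_ _. 0" and c = "\<lambda>_. c"]) auto

lemma form_mult:
  assumes "form n m F" "form n l G"
  shows "form n (m + l) (\<lambda>v. F v * G v)"
proof -
  from assms obtain A c B b where A: "finite A" "\<forall>\<alpha>\<in>A. (\<Sum>i\<le>n. \<alpha> i) = m"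
    "F = (\<lambda>v. \<Sum>\<alpha>\<in>A. c \<alpha> * (\<Prod>i\<le>n. v i ^ \<alpha> i))"
    and B: "finite B" "\<forall>\<alpha>\<in>B. (\<Sum>i\<le>n. \<alpha> i) = l"
    "G = (\<lambda>v. \<Sum>\<alpha>\<in>B. b \<alpha> * (\<Prod>i\<le>n. v i ^ \<alpha> i))"
    unfolding form_def by blast
  show ?thesis
  proof (rule form_from_family[where K = "A \<times> B" and \<alpha> = "\<lambda>(\<alpha>, \<beta>) i. \<alpha> i + \<beta> i"
      and c = "\<lambda>(\<alpha>, \<beta>). c \<alpha> * b \<beta>"])
    show "(\<lambda>v. F v * G v) = (\<lambda>v. \<Sum>k\<in>A \<times> B. (case k of (\<alpha>, \<beta>) \<Rightarrow> c \<alpha> * b \<beta>) *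
        (\<Prod>i\<le>n. v i ^ (case k of (\<alpha>, \<beta>) \<Rightarrow> \<lambda>i. \<alpha> i + \<beta> i) i))"
      unfolding A(3) B(3) sum_product
      by (simp add: sum.cartesian_product case_prod_beta power_add prod.distrib mult_ac)
  qed (use A B in \<open>auto simp: sum.distrib\<close>)
qed

lemma form_add:
  assumes "form n m F" "form n m G"
  shows "form n m (\<lambda>v. F v + G v)"
proof -
  from assms obtain A c B b where A: "finite A" "\<forall>\<alpha>\<in>A. (\<Sum>i\<le>n. \<alpha> i) = m"
    "F = (\<lambda>v. \<Sum>\<alpha>\<in>A. c \<alpha> * (\<Prod>i\<le>n. v i ^ \<alpha> i))"
    and B: "finite B" "\<forall>\<alpha>\<in>B. (\<Sum>i\<le>n. \<alpha> i) = m"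
    "G = (\<lambda>v. \<Sum>\<alpha>\<in>B. b \<alpha> * (\<Prod>i\<le>n. v i ^ \<alpha> i))"
    unfolding form_def by blast
  show ?thesis
    by (rule form_from_family[where K = "Inl ` A \<union> Inr ` B" and \<alpha> = "case_sum (\<lambda>x. x) (\<lambda>x. x)"
      and c = "case_sum c b"])
      (use A B in \<open>auto simp: sum.Plus[unfolded Plus_def] fun_eq_iff\<close>)
qed

lemma form_cmult: "form n m F \<Longrightarrow> form n m (\<lambda>v. c * F v)"
  using form_mult[OF form_const, of n m F c] unfolding add_0 .

lemma form_power: "form n m F \<Longrightarrow> form n (k * m) (\<lambda>v. F v ^ k)"
proof (induction k)
  case 0
  show ?case using form_const[of n 1] by simp
next
  case (Suc k)
  then show ?case using form_mult[of n m F "k * m" "\<lambda>v. F v ^ k"] by simp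
qed

lemma form_homogeneous:
  assumes "form n m F"
  shows "F (\<lambda>i. c * v i) = c ^ m * F v"
proof -
  from assms obtain A b where A: "\<forall>\<alpha>\<in>A. (\<Sum>i\<le>n. \<alpha> i) = m"
    "F = (\<lambda>v. \<Sum>\<alpha>\<in>A. b \<alpha> * (\<Prod>i\<le>n. v i ^ \<alpha> i))"
    unfolding form_def by blast
  show ?thesis unfolding A(2) sum_distrib_left
    by (intro sum.cong) (use A(1) in \<open>auto simp: power_mult_distrib prod.distrib power_sum mult_ac\<close>)
qed

text \<open>
  Substituting an arbitrary polynomial for the coordinate \<open>l\<close> of a moving point on a line lets
  a single bivariate polynomial compute a form both on the line and on the planes swept out by \<open>l\<close>.
\<close>

lemma form_bivariate:
  fixes F :: "(nat \<Rightarrow> 'k::field) \<Rightarrow> 'k"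
  assumes "form n m F"
  obtains P :: "'k poly poly" where
    "\<And>S t. poly (poly P S) t = F (\<lambda>i. if i = l then poly S t else v i + t * w i)"
proof -
  from assms obtain A b where A: "F = (\<lambda>v. \<Sum>\<alpha>\<in>A. b \<alpha> * (\<Prod>i\<le>n. v i ^ \<alpha> i))"
    unfolding form_def by blast
  define P :: "'k poly poly" where
    "P = (\<Sum>\<alpha>\<in>A. [:[:b \<alpha>:]:] * (\<Prod>i\<le>n. (if i = l then [:0, 1:] else [:[:v i, w i:]:]) ^ \<alpha> i))"
  have "poly (poly (if i = l then [:0, 1:] else [:[:v i, w i:]:]) S) t
      = (if i = l then poly S t else v i + t * w i)" for i S t
    by simp
  then have "poly (poly P S) t = F (\<lambda>i. if i = l then poly S t else v i + t * w i)" for S t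
    unfolding A P_def by (simp only: poly_sum poly_mult poly_prod poly_power) simp
  then show ?thesis using that by blast
qed

section \<open>Lines and points in homogeneous coordinates\<close>

definition line :: "(nat \<Rightarrow> 'k::field) \<Rightarrow> (nat \<Rightarrow> 'k) \<Rightarrow> 'k \<Rightarrow> nat \<Rightarrow> 'k" where
  "line v w t = (\<lambda>i. v i + t * w i)"

lemma form_along_line:
  assumes "form n m F"
  obtains P where "\<And>t. poly P t = F (line v w t)"
proof -
  obtain P where P: "\<And>S t. poly (poly P S) t = F (\<lambda>i. if i = 0 then poly S t else v i + t * w i)"
    using form_bivariate[OF assms, of 0 v w] by blast
  have "(\<lambda>i. if i = 0 then poly [:v 0, w 0:] t else v i + t * w i) = line v w t" for t
    by (auto simp: line_def fun_eq_iff)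
  then show ?thesis using P[of "[:v 0, w 0:]"] that by metis
qed

definition proj_point :: "(nat \<Rightarrow> 'k::field) \<Rightarrow> 'k ppoint" where
  "proj_point v = {(\<lambda>i. c * v i) | c. c \<noteq> 0}"

lemma proj_space_iff:
  "x \<in> proj_space n \<longleftrightarrow> (\<exists>v. x = proj_point v \<and> v \<noteq> (\<lambda>_. 0) \<and> (\<forall>i>n. v i = 0))"
  unfolding proj_space_def proj_point_def by (simp only: mem_Collect_eq)

lemma proj_pointI: "v \<noteq> (\<lambda>_. 0) \<Longrightarrow> (\<And>i. i > n \<Longrightarrow> v i = 0) \<Longrightarrow> proj_point v \<in> proj_space n"
  unfolding proj_space_iff by (intro exI[of _ v]) simp

lemma self_in_proj_point: "v \<in> proj_point v"
  unfolding proj_point_def by (rule CollectI, rule exI[of _ 1]) simp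

lemma proj_point_scale:
  assumes "c \<noteq> 0"
  shows "proj_point (\<lambda>i. c * v i) = proj_point v"
proof -
  have "\<exists>b'. (\<lambda>i. b * v i) = (\<lambda>i. b' * (c * v i)) \<and> b' \<noteq> 0" if "b \<noteq> 0" for b
    using assms that by (intro exI[of _ "b / c"]) auto
  moreover have "\<exists>b'. (\<lambda>i. b * (c * v i)) = (\<lambda>i. b' * v i) \<and> b' \<noteq> 0" if "b \<noteq> 0" for b
    using assms that by (intro exI[of _ "b * c"]) (auto simp: mult.assoc)
  ultimately show ?thesis unfolding proj_point_def by blast
qed

lemma proj_spaceD:
  assumes "x \<in> proj_space n" "v \<in> x"
  shows "x = proj_point v" "v \<noteq> (\<lambda>_. 0)" "\<And>i. i > n \<Longrightarrow> v i = 0"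
proof -
  from assms obtain u where u: "x = proj_point u" "u \<noteq> (\<lambda>_. 0)" "\<And>i. i > n \<Longrightarrow> u i = 0"
    unfolding proj_space_iff by blast
  with assms obtain c where c: "v = (\<lambda>i. c * u i)" "c \<noteq> 0" unfolding proj_point_def by blast
  show "x = proj_point v" unfolding u c(1) using c(2) by (rule proj_point_scale[symmetric])
  show "v \<noteq> (\<lambda>_. 0)" using u c by (auto simp: fun_eq_iff)
  show "v i = 0" if "i > n" for i using u c that by simp
qed

lemma proj_space_obtain:
  assumes "x \<in> proj_space n"
  obtains v where "v \<in> x" "x = proj_point v" "v \<noteq> (\<lambda>_. 0)" "\<And>i. i > n \<Longrightarrow> v i = 0"
proof -
  from assms obtain v where v: "x = proj_point v" "v \<noteq> (\<lambda>_. 0)" "\<forall>i>n. v i = 0"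
    unfolding proj_space_iff by blast
  show ?thesis by (rule that[of v]) (use v self_in_proj_point in auto)
qed

lemma form_nonzero_on_point:
  assumes "form n m F"
  shows "(\<forall>u\<in>proj_point v. F u \<noteq> 0) \<longleftrightarrow> F v \<noteq> 0"
proof
  assume "F v \<noteq> 0"
  then show "\<forall>u\<in>proj_point v. F u \<noteq> 0"
    unfolding proj_point_def by (auto simp: form_homogeneous[OF assms])
qed (use self_in_proj_point in blast)

section \<open>Principal open sets as a base\<close>

text \<open>The principal open sets generate the topology only as a subbase, but the product of two
  forms cuts out the intersection of their principal open sets, so they are a base.\<close>

lemma openin_zariski_basic:
  assumes "openin (zariski n) U" "x \<in> U"
  obtains m F where "form n m F" "\<forall>v\<in>x. F v \<noteq> 0"
    "{y \<in> proj_space n. \<forall>v\<in>y. F v \<noteq> 0} \<subseteq> U"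
proof -
  have "generate_topology_on {{x \<in> proj_space n. \<forall>v\<in>x. F v \<noteq> 0} | F. \<exists>m. form n m F} U"
    using assms(1) unfolding zariski_def openin_topology_generated_by_iff .
  then have "x \<in> U \<longrightarrow> (\<exists>m F. form n m F \<and> (\<forall>v\<in>x. F v \<noteq> 0) \<and>
    {y \<in> proj_space n. \<forall>v\<in>y. F v \<noteq> 0} \<subseteq> U)"
  proof induction
    case (Int a b)
    show ?case
    proof
      assume "x \<in> a \<inter> b"
      then obtain m F l G where "form n m F" "\<forall>v\<in>x. F v \<noteq> 0" "{y \<in> proj_space n. \<forall>v\<in>y. F v \<noteq> 0} \<subseteq> a"
        "form n l G" "\<forall>v\<in>x. G v \<noteq> 0" "{y \<in> proj_space n. \<forall>v\<in>y. G v \<noteq> 0} \<subseteq> b"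
        using Int.IH by auto
      then show "\<exists>m F. form n m F \<and> (\<forall>v\<in>x. F v \<noteq> 0) \<and> {y \<in> proj_space n. \<forall>v\<in>y. F v \<noteq> 0} \<subseteq> a \<inter> b"
        by (intro exI[of _ "m + l"] exI[of _ "\<lambda>v. F v * G v"]) (auto intro: form_mult)
    qed
  next
    case (UN K)
    then show ?case by (meson Sup_upper UnionE order.trans)
  qed auto
  then show ?thesis using assms(2) that by blast
qed

lemma openin_zariski_nonvanishing:
  "form n m F \<Longrightarrow> openin (zariski n) {y \<in> proj_space n. \<forall>v\<in>y. F v \<noteq> 0}"
  unfolding zariski_def openin_topology_generated_by_iff
  by (rule generate_topology_on.Basis) blast

lemma topspace_zariski [simp]: "topspace (zariski n) = (proj_space n :: 'k::field ppoint set)"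
proof
  show "topspace (zariski n) \<subseteq> (proj_space n :: 'k ppoint set)"
    unfolding zariski_def topology_generated_by_topspace by blast
  have "openin (zariski n) (proj_space n :: 'k ppoint set)"
    using openin_zariski_nonvanishing[OF form_const[of n "1::'k"]] by simp
  then show "proj_space n \<subseteq> topspace (zariski n :: 'k ppoint topology)"
    by (rule openin_subset)
qed

lemma openin_zariski_on_basic:
  assumes "openin (zariski_on n X) U" "x \<in> U"
  obtains m F where "form n m F" "\<forall>v\<in>x. F v \<noteq> 0"
    "\<And>y. y \<in> X \<Longrightarrow> y \<in> proj_space n \<Longrightarrow> \<forall>v\<in>y. F v \<noteq> 0 \<Longrightarrow> y \<in> U"
proof -
  from assms obtain T where T: "openin (zariski n) T" "U = T \<inter> X"
    unfolding openin_subtopology by blast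
  then have "x \<in> T" using assms by blast
  from openin_zariski_basic[OF T(1) this] obtain m F where F: "form n m F" "\<forall>v\<in>x. F v \<noteq> 0"
    "{y \<in> proj_space n. \<forall>v\<in>y. F v \<noteq> 0} \<subseteq> T" .
  show ?thesis
    by (rule that[OF F(1,2)]) (use T(2) F(3) in auto)
qed

lemma openin_zariski_on_nonvanishing:
  "form n m F \<Longrightarrow> openin (zariski_on n X) {y \<in> X \<inter> proj_space n. \<forall>v\<in>y. F v \<noteq> 0}"
  unfolding openin_subtopology
  by (rule exI[of _ "{y \<in> proj_space n. \<forall>v\<in>y. F v \<noteq> 0}"], rule conjI,
      erule openin_zariski_nonvanishing) blast

section \<open>Regular functions\<close>

text \<open>
  The equation of the neighbourhood on which the quotient is valid is absorbed into \<open>H\<close>.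
\<close>

definition local_quotient ::
  "nat \<Rightarrow> 'k::field ppoint set \<Rightarrow> ('k ppoint \<Rightarrow> 'k) \<Rightarrow> ((nat \<Rightarrow> 'k) \<Rightarrow> 'k) \<Rightarrow> ((nat \<Rightarrow> 'k) \<Rightarrow> 'k) \<Rightarrow> bool" where
  "local_quotient n X g G H \<longleftrightarrow> (\<exists>m. form n m G \<and> form n m H) \<and>
     (\<forall>y \<in> X \<inter> proj_space n. \<forall>v\<in>y. H v \<noteq> 0 \<longrightarrow> g y * H v = G v)"

lemma regular_at_iff:
  "regular_at n X x g \<longleftrightarrow>
     x \<in> X \<inter> proj_space n \<and> (\<exists>G H. local_quotient n X g G H \<and> (\<forall>v\<in>x. H v \<noteq> 0))"
proof
  assume "regular_at n X x g"
  then obtain U m G H where U: "openin (zariski_on n X) U" "x \<in> U" "form n m G" "form n m H"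
    "\<forall>y\<in>U. \<forall>v\<in>y. H v \<noteq> 0 \<and> g y = G v / H v"
    unfolding regular_at_def by blast
  from openin_zariski_on_basic[OF U(1,2)] obtain l L where L: "form n l L" "\<forall>v\<in>x. L v \<noteq> 0"
    "\<And>y. y \<in> X \<Longrightarrow> y \<in> proj_space n \<Longrightarrow> \<forall>v\<in>y. L v \<noteq> 0 \<Longrightarrow> y \<in> U" by metis
  have "x \<in> X \<inter> proj_space n" using openin_subset[OF U(1)] U(2) by auto
  moreover have "local_quotient n X g (\<lambda>v. G v * L v) (\<lambda>v. H v * L v)"
    unfolding local_quotient_def
  proof (intro conjI ballI impI exI)
    show "form n (m + l) (\<lambda>v. G v * L v)" "form n (m + l) (\<lambda>v. H v * L v)"
      using U L by (auto intro: form_mult)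
    fix y v assume y: "y \<in> X \<inter> proj_space n" "v \<in> y" "H v * L v \<noteq> 0"
    then have "\<forall>v\<in>y. L v \<noteq> 0"
      using form_nonzero_on_point[OF L(1), of v] proj_spaceD(1)[of y n v] by auto
    then have "y \<in> U" using L y by auto
    then show "g y * (H v * L v) = G v * L v" using U(5) y by auto
  qed
  moreover have "\<forall>v\<in>x. H v * L v \<noteq> 0" using U L by auto
  ultimately show "x \<in> X \<inter> proj_space n \<and> (\<exists>G H. local_quotient n X g G H \<and> (\<forall>v\<in>x. H v \<noteq> 0))"
    by blast
next
  assume "x \<in> X \<inter> proj_space n \<and> (\<exists>G H. local_quotient n X g G H \<and> (\<forall>v\<in>x. H v \<noteq> 0))"
  then obtain m G H where x: "x \<in> X \<inter> proj_space n" "form n m G" "form n m H" "\<forall>v\<in>x. H v \<noteq> 0"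
    "\<forall>y \<in> X \<inter> proj_space n. \<forall>v\<in>y. H v \<noteq> 0 \<longrightarrow> g y * H v = G v"
    unfolding local_quotient_def by blast
  show "regular_at n X x g"
    unfolding regular_at_def
    by (rule exI[of _ "{y \<in> X \<inter> proj_space n. \<forall>v\<in>y. H v \<noteq> 0}"], rule exI[of _ m],
        rule exI[of _ G], rule exI[of _ H])
      (use x openin_zariski_on_nonvanishing[OF x(3)] in \<open>auto simp: field_simps\<close>)
qed

lemma local_quotient_add:
  assumes "local_quotient n X g G H" "local_quotient n X g' G' H'"
  shows "local_quotient n X (\<lambda>y. g y + g' y) (\<lambda>v. G v * H' v + G' v * H v) (\<lambda>v. H v * H' v)"
proof -
  from assms obtain m l where *: "form n m G" "form n m H" "form n l G'" "form n l H'"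
    unfolding local_quotient_def by blast
  have "form n (m + l) (\<lambda>v. G v * H' v + G' v * H v)"
    by (rule form_add) (use form_mult[OF *(1,4)] form_mult[OF *(3,2)] in \<open>simp_all add: add.commute\<close>)
  moreover have "form n (m + l) (\<lambda>v. H v * H' v)" using * by (auto intro!: form_mult)
  moreover have "(g y + g' y) * (H v * H' v) = G v * H' v + G' v * H v"
    if "y \<in> X \<inter> proj_space n" "v \<in> y" "H v * H' v \<noteq> 0" for y v
  proof -
    have "g y * H v = G v" "g' y * H' v = G' v"
      using assms that unfolding local_quotient_def by auto
    moreover have "(g y + g' y) * (H v * H' v) = (g y * H v) * H' v + (g' y * H' v) * H v"
      by (simp add: algebra_simps)
    ultimately show ?thesis by simp
  qed
  ultimately show ?thesis unfolding local_quotient_def by blast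
qed

lemma local_quotient_mult:
  assumes "local_quotient n X g G H" "local_quotient n X g' G' H'"
  shows "local_quotient n X (\<lambda>y. g y * g' y) (\<lambda>v. G v * G' v) (\<lambda>v. H v * H' v)"
proof -
  from assms obtain m l where *: "form n m G" "form n m H" "form n l G'" "form n l H'"
    unfolding local_quotient_def by blast
  have "form n (m + l) (\<lambda>v. G v * G' v)" "form n (m + l) (\<lambda>v. H v * H' v)"
    using * by (auto intro!: form_mult)
  moreover have "g y * g' y * (H v * H' v) = G v * G' v"
    if "y \<in> X \<inter> proj_space n" "v \<in> y" "H v * H' v \<noteq> 0" for y v
  proof -
    have "g y * H v = G v" "g' y * H' v = G' v"
      using assms that unfolding local_quotient_def by auto
    moreover have "g y * g' y * (H v * H' v) = (g y * H v) * (g' y * H' v)" by simp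
    ultimately show ?thesis by simp
  qed
  ultimately show ?thesis unfolding local_quotient_def by blast
qed

lemma local_quotient_const: "local_quotient n X (\<lambda>_. c) (\<lambda>_. c) (\<lambda>_. 1)"
  unfolding local_quotient_def by (intro conjI exI[of _ 0] form_const) simp

lemma regular_at_const: "x \<in> X \<Longrightarrow> x \<in> proj_space n \<Longrightarrow> regular_at n X x (\<lambda>_. c)"
  unfolding regular_at_iff
  by (intro conjI IntI exI[of _ "\<lambda>_. c"] exI[of _ "\<lambda>_. 1"] local_quotient_const) auto

lemma regular_at_add:
  "regular_at n X x g \<Longrightarrow> regular_at n X x h \<Longrightarrow> regular_at n X x (\<lambda>y. g y + h y)"
proof -
  assume "regular_at n X x g" "regular_at n X x h"
  then obtain G H G' H' where *: "x \<in> X \<inter> proj_space n" "local_quotient n X g G H" "\<forall>v\<in>x. H v \<noteq> 0"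
    "local_quotient n X h G' H'" "\<forall>v\<in>x. H' v \<noteq> 0"
    unfolding regular_at_iff by blast
  have "\<forall>v\<in>x. H v * H' v \<noteq> 0" using *(3,5) by simp
  then show ?thesis unfolding regular_at_iff using *(1) local_quotient_add[OF *(2,4)] by blast
qed

lemma regular_at_mult:
  "regular_at n X x g \<Longrightarrow> regular_at n X x h \<Longrightarrow> regular_at n X x (\<lambda>y. g y * h y)"
proof -
  assume "regular_at n X x g" "regular_at n X x h"
  then obtain G H G' H' where *: "x \<in> X \<inter> proj_space n" "local_quotient n X g G H" "\<forall>v\<in>x. H v \<noteq> 0"
    "local_quotient n X h G' H'" "\<forall>v\<in>x. H' v \<noteq> 0"
    unfolding regular_at_iff by blast
  have "\<forall>v\<in>x. H v * H' v \<noteq> 0" using *(3,5) by simp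
  then show ?thesis unfolding regular_at_iff using *(1) local_quotient_mult[OF *(2,4)] by blast
qed

lemma regular_at_power:
  "regular_at n X x g \<Longrightarrow> regular_at n X x (\<lambda>y. g y ^ k)"
proof (induction k)
  case 0
  then show ?case using regular_at_const[of x X n 1] by (simp add: regular_at_iff)
next
  case (Suc k)
  then show ?case using regular_at_mult[of n X x g "\<lambda>y. g y ^ k"] by simp
qed

lemma regular_at_sum:
  assumes "\<And>i. i \<in> I \<Longrightarrow> regular_at n X x (g i)" "x \<in> X" "x \<in> proj_space n"
  shows "regular_at n X x (\<lambda>y. \<Sum>i\<in>I. g i y)"
  using assms
proof (induction I rule: infinite_finite_induct)
  case (insert i I)
  then show ?case using regular_at_add[of n X x "g i"] by simp
qed (simp_all add: regular_at_const)

section \<open>Restriction to a parametrised line\<close>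

text \<open>Numerator and denominator become polynomials along the line. Applied to the two charts,
  this turns regularity on the projective line into rationality in the parameter.\<close>

lemma regular_at_rational:
  assumes "regular_at n X (proj_point (line v w t0)) g" "\<And>t. proj_point (line v w t) \<in> X \<inter> proj_space n"
  shows "rational_at t0 (\<lambda>t. g (proj_point (line v w t)))"
proof -
  from assms(1) obtain G H m where GH: "form n m G" "form n m H" "\<forall>u\<in>proj_point (line v w t0). H u \<noteq> 0"
    "\<forall>y \<in> X \<inter> proj_space n. \<forall>v\<in>y. H v \<noteq> 0 \<longrightarrow> g y * H v = G v"
    unfolding regular_at_iff local_quotient_def by blast
  obtain P where P: "\<And>t. poly P t = G (line v w t)" using form_along_line[OF GH(1)] by metis
  obtain Q where Q: "\<And>t. poly Q t = H (line v w t)" using form_along_line[OF GH(2)] by metis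
  show ?thesis
  proof (rule rational_atI[of 1 t0 Q _ P])
    show "poly Q t0 \<noteq> 0" using GH(3) Q self_in_proj_point[of "line v w t0"] by metis
    fix t assume "poly Q t \<noteq> 0"
    then show "g (proj_point (line v w t)) * poly Q t = poly P t"
      using GH(4) assms(2)[of t] self_in_proj_point[of "line v w t"] unfolding P Q by blast
  qed simp
qed

text \<open>Evaluation at the moving vector \<open>line v w t\<close> trivialises O(a) along the
  chart, so the degree \<open>a\<close> leaves no trace in the conclusion.\<close>

lemma twisting_section_rational:
  assumes "regular_section_at (twisting_bundle n a) (proj_point (line v w t0)) s"
    "\<And>t. proj_point (line v w t) \<in> proj_space n"
  shows "rational_at t0 (\<lambda>t. s (proj_point (line v w t)) (line v w t))"
proof -
  from assms(1) obtain U m l G H where U: "openin (zariski n) U" "proj_point (line v w t0) \<in> U"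
    "form n m G" "form n l H"
    "\<forall>y\<in>U. (\<forall>v\<in>y. H v \<noteq> 0) \<and> s y = (\<lambda>v. if v \<in> y then G v / H v else 0)"
    unfolding twisting_bundle_def by auto
  obtain k L where L: "form n k L" "\<forall>u\<in>proj_point (line v w t0). L u \<noteq> 0"
    "{y \<in> proj_space n. \<forall>v\<in>y. L v \<noteq> 0} \<subseteq> U"
    by (rule openin_zariski_basic[OF U(1,2)])
  obtain P where P: "\<And>t. poly P t = G (line v w t)" using form_along_line[OF U(3)] by metis
  obtain Q where Q: "\<And>t. poly Q t = H (line v w t)" using form_along_line[OF U(4)] by metis
  obtain R where R: "\<And>t. poly R t = L (line v w t)" using form_along_line[OF L(1)] by metis
  show ?thesis
  proof (rule rational_atI[of R t0 Q _ P])
    show "poly R t0 \<noteq> 0" "poly Q t0 \<noteq> 0"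
      using L(2) U(2,5) self_in_proj_point[of "line v w t0"] unfolding Q R by blast+
    fix t assume "poly R t \<noteq> 0" "poly Q t \<noteq> 0"
    then have "\<forall>u\<in>proj_point (line v w t). L u \<noteq> 0"
      unfolding form_nonzero_on_point[OF L(1)] R by simp
    then have U': "proj_point (line v w t) \<in> U" using L(3) assms(2)[of t] by blast
    have "s (proj_point (line v w t)) (line v w t) = poly P t / poly Q t"
      using U(5)[rule_format, OF U'] self_in_proj_point[of "line v w t"] unfolding P Q by simp
    then show "s (proj_point (line v w t)) (line v w t) * poly Q t = poly P t"
      using \<open>poly Q t \<noteq> 0\<close> by simp
  qed
qed

section \<open>Tangent vectors of the Fermat hypersurface\<close>

text \<open>The formal directional derivative. It is a relation because forms are functions: the
  polynomial \<open>P\<close> is known only through its values, which determine it over an infinite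
  field.\<close>

definition has_line_deriv ::
  "((nat \<Rightarrow> 'k::field) \<Rightarrow> 'k) \<Rightarrow> (nat \<Rightarrow> 'k) \<Rightarrow> (nat \<Rightarrow> 'k) \<Rightarrow> 'k \<Rightarrow> bool" where
  "has_line_deriv F v w \<delta> \<longleftrightarrow> (\<exists>P. (\<forall>t. poly P t = F (line v w t)) \<and> poly (pderiv P) 0 = \<delta>)"

lemma line_0 [simp]: "line v w 0 = v"
  by (simp add: line_def)

lemma has_line_derivI:
  "(\<And>t. poly P t = F (line v w t)) \<Longrightarrow> poly (pderiv P) 0 = \<delta> \<Longrightarrow> has_line_deriv F v w \<delta>"
  unfolding has_line_deriv_def by (rule exI[of _ P]) simp

lemma has_line_deriv_exists:
  assumes "form n m F"
  obtains \<delta> where "has_line_deriv F v w \<delta>"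
proof -
  obtain P where "\<And>t. poly P t = F (line v w t)" using form_along_line[OF assms, where v = v and w = w] by blast
  then have "has_line_deriv F v w (poly (pderiv P) 0)" by (rule has_line_derivI) simp
  then show ?thesis by (rule that)
qed

lemma has_line_deriv_mult:
  assumes "has_line_deriv F v w \<delta>" "has_line_deriv G v w \<epsilon>"
  shows "has_line_deriv (\<lambda>u. F u * G u) v w (\<delta> * G v + F v * \<epsilon>)"
proof -
  from assms obtain P Q where *: "\<forall>t. poly P t = F (line v w t)" "poly (pderiv P) 0 = \<delta>"
    "\<forall>t. poly Q t = G (line v w t)" "poly (pderiv Q) 0 = \<epsilon>"
    unfolding has_line_deriv_def by blast
  show ?thesis
    by (rule has_line_derivI[of "P * Q"])
      (simp_all add: pderiv_mult *(2,4) *(1)[rule_format] *(3)[rule_format])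
qed

lemma has_line_deriv_add:
  assumes "has_line_deriv F v w \<delta>" "has_line_deriv G v w \<epsilon>"
  shows "has_line_deriv (\<lambda>u. F u + G u) v w (\<delta> + \<epsilon>)"
proof -
  from assms obtain P Q where *: "\<forall>t. poly P t = F (line v w t)" "poly (pderiv P) 0 = \<delta>"
    "\<forall>t. poly Q t = G (line v w t)" "poly (pderiv Q) 0 = \<epsilon>"
    unfolding has_line_deriv_def by blast
  show ?thesis
    by (rule has_line_derivI[of "P + Q"])
      (simp_all add: pderiv_add *(2,4) *(1)[rule_format] *(3)[rule_format])
qed

lemma has_line_deriv_const: "has_line_deriv (\<lambda>_. c) v w 0"
  by (rule has_line_derivI[of "[:c:]"]) (simp_all add: pderiv_pCons)

lemma has_line_deriv_cmult:
  assumes "has_line_deriv F v w \<delta>"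
  shows "has_line_deriv (\<lambda>u. c * F u) v w (c * \<delta>)"
  using has_line_deriv_mult[OF has_line_deriv_const assms, of c] by simp

lemma has_line_deriv_coord: "has_line_deriv (\<lambda>u. u i) v w (w i)"
  by (rule has_line_derivI[of "[:v i, w i:]"]) (simp_all add: pderiv_pCons line_def)

lemma has_line_deriv_unique:
  fixes F :: "(nat \<Rightarrow> 'k::alg_closed_field) \<Rightarrow> 'k"
  assumes "has_line_deriv F v w \<delta>" "has_line_deriv F v w \<epsilon>"
  shows "\<delta> = \<epsilon>"
proof -
  from assms obtain P Q where *: "\<forall>t. poly P t = F (line v w t)" "poly (pderiv P) 0 = \<delta>"
    "\<forall>t. poly Q t = F (line v w t)" "poly (pderiv Q) 0 = \<epsilon>"
    unfolding has_line_deriv_def by blast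
  have "P = Q" by (rule poly_eqI_cofinite) (simp add: *(1)[rule_format] *(3)[rule_format])
  then show ?thesis using * by simp
qed

lemma fermat_point_iff:
  fixes u :: "nat \<Rightarrow> 'k::field"
  assumes "u \<noteq> (\<lambda>_. 0)" "\<And>i. i > d \<Longrightarrow> u i = 0"
  shows "proj_point u \<in> fermat_hypersurface d \<longleftrightarrow> (\<Sum>i\<le>d. u i ^ d) = 0"
proof -
  have "(\<Sum>i\<le>d. (c * u i) ^ d) = c ^ d * (\<Sum>i\<le>d. u i ^ d)" for c
    by (simp add: power_mult_distrib sum_distrib_left)
  moreover have "proj_point u \<in> proj_space d" by (rule proj_pointI) (use assms in auto)
  moreover have "u \<in> proj_point u" by (rule self_in_proj_point)
  ultimately show ?thesis
    unfolding fermat_hypersurface_def proj_point_def by auto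
qed

lemma fermat_subset_proj_space: "fermat_hypersurface d \<subseteq> proj_space d"
  unfolding fermat_hypersurface_def by blast

lemma poly_map_poly_eval:
  fixes R :: "'k::comm_ring_1 poly poly"
  shows "poly (map_poly (\<lambda>p. poly p t) R) y = poly (poly R [:y:]) t"
  by (induction R) (simp_all add: map_poly_pCons)

text \<open>
  A form vanishing on the hypersurface near \<open>v\<close> is, on the planes spanned by a tangent direction and
  a coordinate \<open>l\<close> with \<open>v l \<noteq> 0\<close>, divisible by the (monic, separable in \<open>l\<close>) Fermat equation; this
  replaces the Nullstellensatz.
\<close>

lemma fermat_vanishing_deriv:
  fixes \<Phi> L :: "(nat \<Rightarrow> 'k::alg_closed_field) \<Rightarrow> 'k"
  assumes q: "of_nat q = (0::'k)" "q > 0"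
    and forms: "form d m \<Phi>" "form d k L" "L v \<noteq> 0"
    and v: "v \<noteq> (\<lambda>_. 0)" "\<And>i. i > d \<Longrightarrow> v i = 0" "(\<Sum>i\<le>d. v i ^ (q + 1)) = 0"
    and w: "\<And>i. i > d \<Longrightarrow> w i = 0" "(\<Sum>i\<le>d. v i ^ q * w i) = 0"
    and vanish: "\<And>u. u \<noteq> (\<lambda>_. 0) \<Longrightarrow> (\<And>i. i > d \<Longrightarrow> u i = 0) \<Longrightarrow> (\<Sum>i\<le>d. u i ^ (q + 1)) = 0 \<Longrightarrow>
       L u \<noteq> 0 \<Longrightarrow> \<Phi> u = 0"
  shows "has_line_deriv \<Phi> v w 0"
proof -
  from v(1) obtain l where l: "v l \<noteq> 0" by auto
  then have ld: "l \<le> d" using v(2) by (meson not_le)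
  obtain PP where PP: "\<And>S t. poly (poly PP S) t =
      \<Phi> (\<lambda>i. if i = l then poly S t else v i + t * w i) * L (\<lambda>i. if i = l then poly S t else v i + t * w i)"
    using form_bivariate[OF form_mult[OF forms(1,2)], where l = l and v = v and w = w] by blast
  \<comment> \<open>\<open>E\<close> is the Fermat equation with the coordinate \<open>l\<close>
    freed as the main variable; \<open>c\<close> collects the other coordinates, which move along
    the line.\<close>
  define c where "c = (\<Sum>i\<in>{..d} - {l}. [:v i, w i:] ^ (q + 1))"
  define E where "E = monom (1::'k poly) (q + 1) + [:c:]"
  have split: "(\<Sum>i\<le>d. f i) = f l + (\<Sum>i\<in>{..d} - {l}. f i)" for f :: "nat \<Rightarrow> 'k"
    by (rule sum.remove) (use ld in auto)
  have split': "(\<Sum>i\<le>d. f i) = f l + (\<Sum>i\<in>{..d} - {l}. f i)" for f :: "nat \<Rightarrow> 'k poly"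
    by (rule sum.remove) (use ld in auto)
  have c_eval: "poly c t = (\<Sum>i\<in>{..d} - {l}. (v i + t * w i) ^ (q + 1))" for t
    unfolding c_def poly_sum poly_power by simp
  have "poly c 0 = - (v l ^ (q + 1))"
    using v(3) unfolding c_eval split by (simp add: eq_neg_iff_add_eq_0 add.commute)
  then have c0: "poly c 0 \<noteq> 0" using l by simp
  then have "c \<noteq> 0" by auto
  have degE: "degree E = q + 1"
    unfolding E_def by (subst degree_add_eq_left) (auto simp: degree_monom_eq)
  then have lcE: "coeff E (degree E) = 1" unfolding E_def by (simp add: coeff_pCons)
  have "E \<noteq> 0" using degE by auto
  \<comment> \<open>\<open>E\<close> is monic, so pseudo-division is genuine division with remainder
    over the polynomials in \<open>t\<close>.\<close>
  obtain Q R where QR: "pseudo_divmod PP E = (Q, R)" by (cases "pseudo_divmod PP E")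
  have div: "PP = E * Q + R" "R = 0 \<or> degree R < degree E"
    using pseudo_divmod[OF \<open>E \<noteq> 0\<close> QR] unfolding lcE by simp_all
  \<comment> \<open>The specialised equation has only simple roots: its derivative is
    \<open>y ^ q\<close>, as \<open>q + 1\<close> equals 1 in the field, and 0 is not a root. The
    remainder vanishes at all these roots but has smaller degree.\<close>
  have Rt: "map_poly (\<lambda>p. poly p t) R = 0" if ct: "poly c t \<noteq> 0" for t
  proof -
    define Et where "Et = monom 1 (q + 1) + [:poly c t:]"
    have degEt: "degree Et = q + 1"
      unfolding Et_def by (subst degree_add_eq_left) (auto simp: degree_monom_eq)
    have Et_eval: "poly Et y = y ^ (q + 1) + poly c t" for y
      unfolding Et_def by (simp add: poly_monom)
    have Et_deriv: "poly (pderiv Et) y = y ^ q" for y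
      unfolding Et_def using q(1) by (simp add: pderiv_add pderiv_monom pderiv_pCons poly_monom)
    have "Et dvd map_poly (\<lambda>p. poly p t) R"
    proof (rule simple_roots_imp_dvd)
      show "Et \<noteq> 0" using degEt by auto
      show "\<not> (poly Et y = 0 \<and> poly (pderiv Et) y = 0)" for y
        unfolding Et_eval Et_deriv using ct by auto
      fix y assume y: "poly Et y = 0"
      define u where "u i = (if i = l then y else v i + t * w i)" for i
      have "y \<noteq> 0" using y ct unfolding Et_eval by auto
      then have "u \<noteq> (\<lambda>_. 0)" unfolding u_def by (metis (full_types))
      moreover have "u i = 0" if "i > d" for i using that ld v(2) w(1) by (simp add: u_def)
      moreover have "(\<Sum>i\<le>d. u i ^ (q + 1)) = 0"
        using y unfolding Et_eval split c_eval by (simp add: u_def)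
      ultimately have "\<Phi> u * L u = 0" using vanish[of u] by (cases "L u = 0") auto
      then have "poly (poly PP [:y:]) t = 0" unfolding PP u_def[abs_def] by (simp cong: if_cong)
      moreover have "poly (poly E [:y:]) t = 0"
        using y unfolding Et_eval E_def by (simp add: poly_monom)
      ultimately have "poly (poly R [:y:]) t = 0" unfolding div(1) by simp
      then show "poly (map_poly (\<lambda>p. poly p t) R) y = 0" by (simp add: poly_map_poly_eval)
    qed
    moreover have "degree (map_poly (\<lambda>p. poly p t) R) < degree Et"
    proof -
      have "degree (map_poly (\<lambda>p. poly p t) R) \<le> degree R"
        by (rule degree_le) (simp add: coeff_map_poly coeff_eq_0)
      then show ?thesis using div(2) degE degEt by auto
    qed
    ultimately show ?thesis using dvd_imp_degree_le by (metis not_le)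
  qed
  have "R = 0"
  proof (rule poly_eqI)
    fix j
    \<comment> \<open>The factor \<open>c\<close> takes care of the parameters excluded in
      \<open>Rt\<close>.\<close>
    have "c * coeff R j = 0"
    proof (rule poly_eqI_cofinite)
      have "poly (c * coeff R j) t = 0" for t
      proof (cases "poly c t = 0")
        case False
        have "coeff (map_poly (\<lambda>p. poly p t) R) j = 0" using Rt[OF False] by simp
        then show ?thesis by (simp add: coeff_map_poly)
      qed simp
      then show "finite {t. poly (c * coeff R j) t \<noteq> poly 0 t}" by simp
    qed
    then show "coeff R j = coeff 0 j" using \<open>c \<noteq> 0\<close> by simp
  qed
  \<comment> \<open>Substituting the line's own \<open>l\<close>-th coordinate returns to the line
    through \<open>v\<close> in direction \<open>w\<close>.\<close>
  define S where "S = [:v l, w l:]"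
  define Ev where "Ev = (\<Sum>i\<le>d. [:v i, w i:] ^ (q + 1))"
  obtain P where P: "\<And>t. poly P t = \<Phi> (line v w t)" using form_along_line[OF forms(1), where v = v and w = w] by blast
  obtain PL where PL: "\<And>t. poly PL t = L (line v w t)" using form_along_line[OF forms(2), where v = v and w = w] by blast
  have "P * PL = poly PP S"
  proof (rule poly_eqI_cofinite)
    have "(\<lambda>i. if i = l then poly S t else v i + t * w i) = line v w t" for t
      by (auto simp: line_def S_def)
    then have "poly (P * PL) t = poly (poly PP S) t" for t by (simp add: PP P PL)
    then show "finite {t. poly (P * PL) t \<noteq> poly (poly PP S) t}" by simp
  qed
  also have "\<dots> = Ev * poly Q S"
    unfolding div(1) \<open>R = 0\<close> E_def Ev_def split' c_def S_def by (simp add: poly_monom)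
  finally have eq: "P * PL = Ev * poly Q S" .
  \<comment> \<open>\<open>Ev\<close> has a double zero at 0, because \<open>v\<close> lies on the
    hypersurface and \<open>w\<close> is tangent; dividing by \<open>L\<close>, which is nonzero at
    \<open>v\<close>, passes this on to the form.\<close>
  have Ev0: "poly Ev 0 = 0" using v(3) unfolding Ev_def poly_sum poly_power by simp
  have "pderiv (sum f I) = (\<Sum>i\<in>I. pderiv (f i))" for f :: "nat \<Rightarrow> 'k poly" and I
    by (induction I rule: infinite_finite_induct) (simp_all add: pderiv_add)
  then have "poly (pderiv Ev) 0 = (\<Sum>i\<le>d. poly (pderiv ([:v i, w i:] ^ Suc q)) 0)"
    by (simp only: Ev_def poly_sum Suc_eq_plus1)
  also have "\<dots> = (\<Sum>i\<le>d. v i ^ q * w i)"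
    unfolding pderiv_power_Suc using q(1) by (simp add: pderiv_pCons mult.commute)
  finally have "poly (pderiv Ev) 0 = (\<Sum>i\<le>d. v i ^ q * w i)" .
  then have Ev1: "poly (pderiv Ev) 0 = 0" using w(2) by simp
  have PL0: "poly PL 0 \<noteq> 0" using forms(3) by (simp add: PL)
  have "poly P 0 * poly PL 0 = 0" using arg_cong[OF eq, of "\<lambda>p. poly p 0"] Ev0 by simp
  then have P0: "poly P 0 = 0" using PL0 by simp
  have "poly (pderiv (P * PL)) 0 = 0" unfolding eq pderiv_mult using Ev0 Ev1 by simp
  then have "poly (pderiv P) 0 = 0" unfolding pderiv_mult using P0 PL0 by simp
  with P show ?thesis by (rule has_line_derivI)
qed

text \<open>The affine coordinate function on the chart where coordinate \<open>j\<close> is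
  nonzero. The choice of representative is harmless because the ratio is invariant under
  scaling.\<close>

definition coord_ratio :: "nat \<Rightarrow> nat \<Rightarrow> 'k::field ppoint \<Rightarrow> 'k" where
  "coord_ratio i j y = (SOME v. v \<in> y) i / (SOME v. v \<in> y) j"

lemma coord_ratio_proj_point: "coord_ratio i j (proj_point v) = v i / v j"
proof -
  have "(SOME u. u \<in> proj_point v) \<in> proj_point v"
    by (rule someI[of _ v]) (rule self_in_proj_point)
  then obtain c where "(SOME u. u \<in> proj_point v) = (\<lambda>i. c * v i)" "c \<noteq> 0"
    unfolding proj_point_def by blast
  then show ?thesis unfolding coord_ratio_def by simp
qed

lemma local_quotient_coord_ratio:
  assumes "i \<le> n" "j \<le> n"
  shows "local_quotient n X (coord_ratio i j) (\<lambda>u. u i) (\<lambda>u. u j)"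
  unfolding local_quotient_def
proof (intro conjI ballI impI exI)
  show "form n 1 (\<lambda>u :: nat \<Rightarrow> 'a. u i)" "form n 1 (\<lambda>u :: nat \<Rightarrow> 'a. u j)"
    by (rule form_coord, fact)+
  fix y and v :: "nat \<Rightarrow> 'a" assume y: "y \<in> X \<inter> proj_space n" "v \<in> y" "v j \<noteq> 0"
  then have "y = proj_point v" using proj_spaceD(1)[of y n v] by blast
  then show "coord_ratio i j y * v j = v i" using y by (simp add: coord_ratio_proj_point)
qed

text \<open>\<open>D\<close> is differentiation along \<open>w\<close> by the quotient rule;
  \<open>fermat_vanishing_deriv\<close> makes it independent of numerator, denominator and
  neighbourhood. The last formula says that \<open>w\<close> is the chart-\<open>j\<close> lift of
  \<open>D\<close> plus a multiple of \<open>v\<close>.\<close>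

lemma fermat_tangent_vector:
  fixes v w :: "nat \<Rightarrow> 'k::alg_closed_field"
  assumes q: "of_nat q = (0::'k)" "q > 0" and d: "d = q + 1"
    and v: "v \<noteq> (\<lambda>_. 0)" "\<And>i. i > d \<Longrightarrow> v i = 0" "proj_point v \<in> fermat_hypersurface d"
    and w: "\<And>i. i > d \<Longrightarrow> w i = 0" "(\<Sum>i\<le>d. v i ^ q * w i) = 0"
  obtains D where "D \<in> tangent_space d (fermat_hypersurface d) (proj_point v)"
    "\<And>i j. i \<le> d \<Longrightarrow> j \<le> d \<Longrightarrow> v j \<noteq> 0 \<Longrightarrow> w i = v i / v j * w j + D (coord_ratio i j) * v j"
proof -
  define X :: "'k ppoint set" where "X = fermat_hypersurface d"
  define x where "x = proj_point v"
  have xX: "x \<in> X \<inter> proj_space d"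
    using v(3) fermat_subset_proj_space unfolding X_def x_def by blast
  have vx: "v \<in> x" unfolding x_def by (rule self_in_proj_point)
  have v0: "(\<Sum>i\<le>d. v i ^ (q + 1)) = 0"
    using v(3) fermat_point_iff[OF v(1,2)] d by simp
  \<comment> \<open>The quotient rule cleared of denominators: \<open>\<delta>\<close> is the
    derivative along \<open>w\<close> of the function \<open>g = G / H\<close> at
    \<open>v\<close>.\<close>
  define dq where "dq g \<delta> \<longleftrightarrow> (\<exists>G H dG dH. local_quotient d X g G H \<and> H v \<noteq> 0 \<and>
    has_line_deriv G v w dG \<and> has_line_deriv H v w dH \<and> dG = g x * dH + \<delta> * H v)" for g \<delta>
  have at_v: "g x * H v = G v" if "local_quotient d X g G H" "H v \<noteq> 0" for g G H
    using that xX vx unfolding local_quotient_def by blast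
  have reg_iff: "regular_at d X x g \<longleftrightarrow> (\<exists>G H. local_quotient d X g G H \<and> H v \<noteq> 0)" for g
  proof -
    have "(\<forall>u\<in>x. H u \<noteq> 0) \<longleftrightarrow> H v \<noteq> 0" if "local_quotient d X g G H" for G H
      using that form_nonzero_on_point unfolding local_quotient_def x_def by blast
    then show ?thesis unfolding regular_at_iff using xX by blast
  qed
  have dq_regular: "regular_at d X x g" if "dq g \<delta>" for g \<delta>
    using that unfolding dq_def reg_iff by blast
  have dq_exists: "\<exists>\<delta>. dq g \<delta>" if "regular_at d X x g" for g
  proof -
    from that obtain G H where GH: "local_quotient d X g G H" "H v \<noteq> 0" unfolding reg_iff by blast
    then obtain m where m: "form d m G" "form d m H" unfolding local_quotient_def by blast
    obtain dG where dG: "has_line_deriv G v w dG" using has_line_deriv_exists[OF m(1)] by blast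
    obtain dH where dH: "has_line_deriv H v w dH" using has_line_deriv_exists[OF m(2)] by blast
    have "dG = g x * dH + (dG - g x * dH) / H v * H v" using GH by simp
    then show ?thesis unfolding dq_def using GH dG dH by blast
  qed
  have dq_unique: "\<delta> = \<epsilon>" if dq: "dq g \<delta>" "dq h \<epsilon>" "\<forall>y\<in>U. g y = h y"
      "openin (zariski_on d X) U" "x \<in> U" for g h \<delta> \<epsilon> U
  proof -
    from dq obtain G H dG dH G' H' dG' dH' where
      *: "local_quotient d X g G H" "H v \<noteq> 0" "has_line_deriv G v w dG" "has_line_deriv H v w dH"
        "dG = g x * dH + \<delta> * H v"
      and **: "local_quotient d X h G' H'" "H' v \<noteq> 0" "has_line_deriv G' v w dG'"
        "has_line_deriv H' v w dH'" "dG' = h x * dH' + \<epsilon> * H' v"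
      unfolding dq_def by blast
    obtain k L where L: "form d k L" "\<forall>v\<in>x. L v \<noteq> 0"
      "\<And>y. y \<in> X \<Longrightarrow> y \<in> proj_space d \<Longrightarrow> \<forall>v\<in>y. L v \<noteq> 0 \<Longrightarrow> y \<in> U"
      using openin_zariski_on_basic[OF dq(4,5)] by blast
    obtain m m' where m: "form d m G" "form d m H" "form d m' G'" "form d m' H'"
      using *(1) **(1) unfolding local_quotient_def by blast
    \<comment> \<open>Two representations of the same germ are compared through their cross
      difference; multiplying both denominators with \<open>L\<close> confines attention to points
      where both representations hold and the germs agree.\<close>
    have form1: "form d (m + m') (\<lambda>u. G u * H' u + (- 1) * (G' u * H u))"
      by (rule form_add[OF form_mult[OF m(1,4)] form_cmult])
        (use form_mult[OF m(3,2)] in \<open>simp add: add.commute\<close>)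
    have form2: "form d (m + m' + k) (\<lambda>u. H u * H' u * L u)"
      by (rule form_mult[OF form_mult[OF m(2,4)] L(1)])
    have nz: "H v * H' v * L v \<noteq> 0" using *(2) **(2) L(2) vx by simp
    have vanish: "G u * H' u + (- 1) * (G' u * H u) = 0"
      if u: "u \<noteq> (\<lambda>_. 0)" "\<And>i. i > d \<Longrightarrow> u i = 0" "(\<Sum>i\<le>d. u i ^ (q + 1)) = 0"
        "H u * H' u * L u \<noteq> 0" for u
    proof -
      have P: "proj_point u \<in> X \<inter> proj_space d"
      proof
        show "proj_point u \<in> X"
          unfolding X_def using fermat_point_iff[OF u(1,2)] u(3) d by simp
        then show "proj_point u \<in> proj_space d"
          unfolding X_def using fermat_subset_proj_space by blast
      qed
      have "\<forall>v\<in>proj_point u. L v \<noteq> 0"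
        using form_nonzero_on_point[OF L(1)] u(4) by simp
      then have "proj_point u \<in> U" using L(3) P by blast
      then have gh: "g (proj_point u) = h (proj_point u)" using dq(3) by blast
      have "g (proj_point u) * H u = G u" "h (proj_point u) * H' u = G' u"
        using *(1) **(1) P u(4) self_in_proj_point[of u] unfolding local_quotient_def by auto
      then have "G u = h (proj_point u) * H u" "G' u = h (proj_point u) * H' u"
        using gh by auto
      then show ?thesis by simp
    qed
    have 0: "has_line_deriv (\<lambda>u. G u * H' u + (- 1) * (G' u * H u)) v w 0"
      by (rule fermat_vanishing_deriv[OF q form1 form2 nz v(1,2) v0 w]) (assumption | rule vanish)+
    have "has_line_deriv (\<lambda>u. G u * H' u + (- 1) * (G' u * H u)) v w
      ((dG * H' v + G v * dH') + (- 1) * (dG' * H v + G' v * dH))"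
      by (intro has_line_deriv_add has_line_deriv_cmult has_line_deriv_mult * **)
    from has_line_deriv_unique[OF 0 this]
    have eq: "dG * H' v + G v * dH' = dG' * H v + G' v * dH" by (simp add: algebra_simps)
    have gh: "g x = h x" using dq by blast
    have "G v = h x * H v" "G' v = h x * H' v"
      using at_v[OF *(1,2)] at_v[OF **(1,2)] gh by auto
    then have "(\<delta> - \<epsilon>) * (H v * H' v) = 0"
      using eq unfolding *(5) **(5) gh by (simp add: algebra_simps)
    then show ?thesis using *(2) **(2) by simp
  qed
  have dq_unique': "\<delta> = \<epsilon>" if "dq g \<delta>" "dq g \<epsilon>" for g \<delta> \<epsilon>
  proof (rule dq_unique[OF that])
    show "openin (zariski_on d X) (topspace (zariski_on d X))" by (rule openin_topspace)
    show "x \<in> topspace (zariski_on d X)" using xX by simp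
  qed simp
  have dq_const: "dq (\<lambda>y. c) 0" for c
    unfolding dq_def using local_quotient_const[of d X c] has_line_deriv_const
    by (intro exI[of _ "\<lambda>_. c"] exI[of _ "\<lambda>_. 1"] exI[of _ 0]) auto
  have dq_add: "dq (\<lambda>y. g y + h y) (\<delta> + \<epsilon>)"
    and dq_mult: "dq (\<lambda>y. g y * h y) (g x * \<epsilon> + h x * \<delta>)" if dq: "dq g \<delta>" "dq h \<epsilon>" for g h \<delta> \<epsilon>
  proof -
    from dq obtain G H dG dH G' H' dG' dH' where
      *: "local_quotient d X g G H" "H v \<noteq> 0" "has_line_deriv G v w dG" "has_line_deriv H v w dH"
        "dG = g x * dH + \<delta> * H v"
      and **: "local_quotient d X h G' H'" "H' v \<noteq> 0" "has_line_deriv G' v w dG'"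
        "has_line_deriv H' v w dH'" "dG' = h x * dH' + \<epsilon> * H' v"
      unfolding dq_def by blast
    have Gv: "G v = g x * H v" "G' v = h x * H' v"
      using at_v[OF *(1,2)] at_v[OF **(1,2)] by auto
    have H: "H v * H' v \<noteq> 0" using *(2) **(2) by simp
    have dH: "has_line_deriv (\<lambda>u. H u * H' u) v w (dH * H' v + H v * dH')"
      by (intro has_line_deriv_mult * **)
    have "has_line_deriv (\<lambda>u. G u * H' u + G' u * H u) v w
        ((dG * H' v + G v * dH') + (dG' * H v + G' v * dH))"
      by (intro has_line_deriv_add has_line_deriv_mult * **)
    moreover have "(dG * H' v + G v * dH') + (dG' * H v + G' v * dH)
        = (g x + h x) * (dH * H' v + H v * dH') + (\<delta> + \<epsilon>) * (H v * H' v)"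
      unfolding Gv *(5) **(5) by (simp add: algebra_simps)
    ultimately show "dq (\<lambda>y. g y + h y) (\<delta> + \<epsilon>)"
      unfolding dq_def using local_quotient_add[OF *(1) **(1)] dH H
      by (intro exI conjI)
    have "has_line_deriv (\<lambda>u. G u * G' u) v w (dG * G' v + G v * dG')"
      by (intro has_line_deriv_mult * **)
    moreover have "dG * G' v + G v * dG'
        = (g x * h x) * (dH * H' v + H v * dH') + (g x * \<epsilon> + h x * \<delta>) * (H v * H' v)"
      unfolding Gv *(5) **(5) by (simp add: algebra_simps)
    ultimately show "dq (\<lambda>y. g y * h y) (g x * \<epsilon> + h x * \<delta>)"
      unfolding dq_def using local_quotient_mult[OF *(1) **(1)] dH H
      by (intro exI conjI)
  qed
  define D where "D g = (if regular_at d X x g then (THE \<delta>. dq g \<delta>) else 0)" for g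
  have D: "dq g (D g)" if reg: "regular_at d X x g" for g
  proof -
    obtain \<delta> where "dq g \<delta>" using dq_exists[OF reg] by blast
    then have "dq g (THE \<delta>. dq g \<delta>)" by (rule theI) (rule dq_unique'[OF _ \<open>dq g \<delta>\<close>])
    then show ?thesis using reg by (simp add: D_def)
  qed
  have D_eq: "D g = \<delta>" if "dq g \<delta>" for g \<delta>
    using dq_unique'[OF D[OF dq_regular[OF that]] that] .
  have "D \<in> tangent_space d X x"
    unfolding tangent_space_def
  proof (intro CollectI conjI allI impI)
    show "D g = 0" if "\<not> regular_at d X x g" for g using that by (simp add: D_def)
  next
    fix g h U assume *: "regular_at d X x g \<and> openin (zariski_on d X) U \<and> x \<in> U \<and> (\<forall>y\<in>U. g y = h y)"
    \<comment> \<open>\<open>D\<close> is 0 by default on functions that are not regular, so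
      regularity must first be carried over to \<open>h\<close>.\<close>
    have "regular_at d X x h"
    proof -
      from * obtain U' m G H where U': "openin (zariski_on d X) U'" "x \<in> U'" "form d m G" "form d m H"
        "\<forall>y\<in>U'. \<forall>v\<in>y. H v \<noteq> 0 \<and> g y = G v / H v"
        unfolding regular_at_def by blast
      then have "openin (zariski_on d X) (U \<inter> U')" using * by (intro openin_Int) auto
      moreover have "\<forall>y\<in>U \<inter> U'. \<forall>v\<in>y. H v \<noteq> 0 \<and> h y = G v / H v" using U'(5) * by auto
      ultimately show ?thesis unfolding regular_at_def using * U'(2,3,4)
        by (intro exI[of _ "U \<inter> U'"] exI[of _ m] exI[of _ G] exI[of _ H]) auto
    qed
    then show "D g = D h" using dq_unique[OF D D] * by blast
  next
    fix c g assume "regular_at d X x g"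
    then have "dq (\<lambda>y. c * g y) (c * D g + g x * 0)" by (rule dq_mult[OF dq_const D])
    then show "D (\<lambda>y. c * g y) = c * D g" using D_eq by simp
  next
    fix g h assume "regular_at d X x g \<and> regular_at d X x h"
    then have "dq g (D g)" "dq h (D h)" using D by auto
    then show "D (\<lambda>y. g y + h y) = D g + D h" "D (\<lambda>y. g y * h y) = g x * D h + h x * D g"
      using D_eq[OF dq_add] D_eq[OF dq_mult] by auto
  qed
  moreover have "w i = v i / v j * w j + D (coord_ratio i j) * v j"
    if ij: "i \<le> d" "j \<le> d" "v j \<noteq> 0" for i j
  proof -
    have "w i = coord_ratio i j x * w j + (w i - coord_ratio i j x * w j) / v j * v j"
      using ij by simp
    then have "dq (coord_ratio i j) ((w i - coord_ratio i j x * w j) / v j)"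
      unfolding dq_def
      using local_quotient_coord_ratio[OF ij(1,2), of X] ij(3) has_line_deriv_coord by blast
    from D_eq[OF this] show ?thesis
      using ij by (simp add: x_def coord_ratio_proj_point)
  qed
  ultimately show ?thesis using that[of D] unfolding X_def x_def by blast
qed

section \<open>Rational curves as tuples of polynomials\<close>

definition unit_vec :: "nat \<Rightarrow> nat \<Rightarrow> 'k::field" where
  "unit_vec j = (\<lambda>i. if i = j then 1 else 0)"

text \<open>The charts [1 : t] and [t : 1]. On the overlap \<open>(1, t)\<close> is \<open>t\<close>
  times \<open>(1 / t, 1)\<close>, the source of every transition factor; the point at infinity is
  \<open>infinite_vec 0\<close>.\<close>

abbreviation "affine_vec \<equiv> line (unit_vec 0) (unit_vec 1)"
abbreviation "infinite_vec \<equiv> line (unit_vec 1) (unit_vec 0)"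

lemma chart_in_P1:
  "proj_point (affine_vec t) \<in> proj_space 1" "proj_point (infinite_vec t) \<in> proj_space 1"
proof -
  have "affine_vec t \<noteq> (\<lambda>_. 0)"
    by (rule notI, drule fun_cong[of _ _ 0]) (simp add: line_def unit_vec_def)
  then show "proj_point (affine_vec t) \<in> proj_space 1"
    by (rule proj_pointI) (simp add: line_def unit_vec_def)
  have "infinite_vec t \<noteq> (\<lambda>_. 0)"
    by (rule notI, drule fun_cong[of _ _ 1]) (simp add: line_def unit_vec_def)
  then show "proj_point (infinite_vec t) \<in> proj_space 1"
    by (rule proj_pointI) (simp add: line_def unit_vec_def)
qed

lemma affine_vec_eq:
  assumes "t \<noteq> 0"
  shows "affine_vec t = (\<lambda>i. t * infinite_vec (inverse t) i)"
  using assms by (auto simp: line_def unit_vec_def fun_eq_iff)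

lemma affine_point_eq:
  assumes "t \<noteq> 0"
  shows "proj_point (affine_vec t) = proj_point (infinite_vec (inverse t))"
  unfolding affine_vec_eq[OF assms] by (rule proj_point_scale[OF assms])

lemma twisting_fibreD:
  assumes "h \<in> fibre (twisting_bundle n a) x"
  shows "\<And>v c. v \<in> x \<Longrightarrow> c \<noteq> 0 \<Longrightarrow> h (\<lambda>i. c * v i) = c powi a * h v" "\<And>v. v \<notin> x \<Longrightarrow> h v = 0"
  using assms unfolding twisting_bundle_def by auto

lemma proj_point_cmult: "x \<in> proj_space n \<Longrightarrow> v \<in> x \<Longrightarrow> c \<noteq> 0 \<Longrightarrow> (\<lambda>i. c * v i) \<in> x"
  using proj_spaceD(1)[of x n v] unfolding proj_point_def by blast

text \<open>Rationality at every parameter makes both chart expressions polynomial; homogeneity of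
  degree \<open>a\<close> under the scaling between the chart vectors gives the gluing
  factor.\<close>

lemma global_twisting_section:
  fixes s :: "'k::alg_closed_field ppoint \<Rightarrow> (nat \<Rightarrow> 'k) \<Rightarrow> 'k"
  assumes "\<And>x. x \<in> proj_space 1 \<Longrightarrow> s x \<in> fibre (twisting_bundle 1 a) x"
    and "\<And>x. x \<in> proj_space 1 \<Longrightarrow> regular_section_at (twisting_bundle 1 a) x s"
  obtains P R where "\<And>t. poly P t = s (proj_point (affine_vec t)) (affine_vec t)"
    "\<And>t. poly R t = s (proj_point (infinite_vec t)) (infinite_vec t)"
    "\<And>t. t \<noteq> 0 \<Longrightarrow> poly P t = t powi a * poly R (inverse t)"
proof -
  have "rational_at t0 (\<lambda>t. s (proj_point (affine_vec t)) (affine_vec t))" for t0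
    by (rule twisting_section_rational[OF assms(2)]) (rule chart_in_P1)+
  then obtain P where P: "\<And>t. s (proj_point (affine_vec t)) (affine_vec t) = poly P t"
    by (rule rational_everywhere_imp_poly) blast
  have "rational_at t0 (\<lambda>t. s (proj_point (infinite_vec t)) (infinite_vec t))" for t0
    by (rule twisting_section_rational[OF assms(2)]) (rule chart_in_P1)+
  then obtain R where R: "\<And>t. s (proj_point (infinite_vec t)) (infinite_vec t) = poly R t"
    by (rule rational_everywhere_imp_poly) blast
  have "poly P t = t powi a * poly R (inverse t)" if "t \<noteq> 0" for t
  proof -
    have "s (proj_point (infinite_vec (inverse t))) (\<lambda>i. t * infinite_vec (inverse t) i)
        = t powi a * s (proj_point (infinite_vec (inverse t))) (infinite_vec (inverse t))"
      by (rule twisting_fibreD(1)[OF assms(1)]) (rule chart_in_P1 self_in_proj_point that)+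
    then show ?thesis
      unfolding P[symmetric] R[symmetric] affine_vec_eq[OF that] proj_point_scale[OF that] .
  qed
  then show ?thesis using that[of P R] P R by simp
qed

lemma bundle_isoE:
  fixes E :: "('k::field, 'a) vbundle" and E' :: "('k, 'b) vbundle"
  assumes "bundle_iso X E E'"
  obtains \<phi> :: "'k ppoint \<Rightarrow> ('a \<Rightarrow> 'k) \<Rightarrow> ('b \<Rightarrow> 'k)" where
    "\<And>x. x \<in> X \<Longrightarrow> bij_betw (\<phi> x) (fibre E x) (fibre E' x)"
    "\<And>x c u. x \<in> X \<Longrightarrow> u \<in> fibre E x \<Longrightarrow> \<phi> x (\<lambda>a. c * u a) = (\<lambda>b. c * \<phi> x u b)"
    "\<And>s x. (\<And>x. x \<in> X \<Longrightarrow> s x \<in> fibre E x) \<Longrightarrow> x \<in> X \<Longrightarrow>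
       regular_section_at E x s \<longleftrightarrow> regular_section_at E' x (\<lambda>y. \<phi> y (s y))"
proof -
  from assms obtain \<phi> :: "'k ppoint \<Rightarrow> ('a \<Rightarrow> 'k) \<Rightarrow> ('b \<Rightarrow> 'k)" where
    1: "\<forall>x\<in>X. bij_betw (\<phi> x) (fibre E x) (fibre E' x) \<and>
        (\<forall>u\<in>fibre E x. \<forall>w\<in>fibre E x. \<phi> x (\<lambda>a. u a + w a) = (\<lambda>b. \<phi> x u b + \<phi> x w b)) \<and>
        (\<forall>c. \<forall>u\<in>fibre E x. \<phi> x (\<lambda>a. c * u a) = (\<lambda>b. c * \<phi> x u b))"
    and 2: "\<forall>s. (\<forall>x\<in>X. s x \<in> fibre E x) \<longrightarrow>
        (\<forall>x\<in>X. regular_section_at E x s \<longleftrightarrow> regular_section_at E' x (\<lambda>y. \<phi> y (s y)))"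
    unfolding bundle_iso_def by (elim exE conjE)
  show ?thesis
    by (rule that[of \<phi>]) (use 1 2 in blast)+
qed

text \<open>The homogeneous coordinate as a section of O(1), extended by zero off the punctured line
  as the fibres require.\<close>

definition coord_section :: "nat \<Rightarrow> 'k::field ppoint \<Rightarrow> (nat \<Rightarrow> 'k) \<Rightarrow> 'k" where
  "coord_section i z = (\<lambda>v. if v \<in> z then v i else 0)"

lemma coord_section_in_fibre:
  "z \<in> proj_space n \<Longrightarrow> coord_section i z \<in> fibre (twisting_bundle n 1) z"
  unfolding twisting_bundle_def coord_section_def by (auto simp: proj_point_cmult)

lemma coord_section_regular:
  fixes z :: "'k::field ppoint"
  assumes "z \<in> proj_space n" "i \<le> n"
  shows "regular_section_at (twisting_bundle n 1) z (coord_section i)"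
proof -
  have "openin (zariski n) (proj_space n :: 'k ppoint set)"
    using openin_topspace[of "zariski n :: 'k ppoint topology"] by simp
  moreover have "form n 1 (\<lambda>v :: nat \<Rightarrow> 'k. v i)" by (rule form_coord) fact
  moreover have "form n 0 (\<lambda>v :: nat \<Rightarrow> 'k. 1)" by (rule form_const)
  ultimately show ?thesis using assms(1)
    unfolding twisting_bundle_def vbundle.select_convs
    by (intro exI[of _ "proj_space n"] exI[of _ 1] exI[of _ 0]
        exI[of _ "\<lambda>v. v i"] exI[of _ "\<lambda>v. 1"] conjI) (simp_all add: coord_section_def cong: if_cong)
qed

text \<open>The coordinate sections are pulled back and carried to O(e) by the isomorphism that
  defines the degree. It is linear on one-dimensional fibres, so it preserves the ratios of the
  coordinates, and injective, so they do not all vanish.\<close>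

lemma curve_polynomials:
  fixes f :: "'k::alg_closed_field ppoint \<Rightarrow> 'k ppoint"
  assumes f: "\<And>y. y \<in> proj_space 1 \<Longrightarrow> f y \<in> proj_space n"
    and deg: "curve_degree n f (int e)"
  obtains F R where
    "\<And>t. (\<lambda>i. if i \<le> n then poly (F i) t else 0) \<in> f (proj_point (affine_vec t))"
    "\<And>t. (\<lambda>i. if i \<le> n then poly (R i) t else 0) \<in> f (proj_point (infinite_vec t))"
    "\<And>i t. i \<le> n \<Longrightarrow> t \<noteq> 0 \<Longrightarrow> poly (F i) t = t ^ e * poly (R i) (inverse t)"
proof -
  define E where "E = pullback 1 (proj_space 1) f (twisting_bundle n 1)"
  have "bundle_iso (proj_space 1) E (twisting_bundle 1 (int e))"
    using deg unfolding curve_degree_def line_bundle_degree_def E_def .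
  then obtain \<phi> :: "'k ppoint \<Rightarrow> ((nat \<Rightarrow> 'k) \<Rightarrow> 'k) \<Rightarrow> ((nat \<Rightarrow> 'k) \<Rightarrow> 'k)" where
    bij: "\<And>x. x \<in> proj_space 1 \<Longrightarrow> bij_betw (\<phi> x) (fibre E x) (fibre (twisting_bundle 1 (int e)) x)" and
    scale: "\<And>x c u. x \<in> proj_space 1 \<Longrightarrow> u \<in> fibre E x \<Longrightarrow> \<phi> x (\<lambda>a. c * u a) = (\<lambda>b. c * \<phi> x u b)" and
    reg: "\<And>s x. (\<And>x. x \<in> proj_space 1 \<Longrightarrow> s x \<in> fibre E x) \<Longrightarrow> x \<in> proj_space 1 \<Longrightarrow>
       regular_section_at E x s \<longleftrightarrow> regular_section_at (twisting_bundle 1 (int e)) x (\<lambda>y. \<phi> y (s y))"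
    by (rule bundle_isoE) blast
  define s where "s i y = coord_section i (f y)" for i y
  have fib: "s i y \<in> fibre E y" if "y \<in> proj_space 1" for i y
    using coord_section_in_fibre[OF f[OF that]] by (simp add: E_def pullback_def s_def)
  have fib': "\<phi> y (s i y) \<in> fibre (twisting_bundle 1 (int e)) y" if "y \<in> proj_space 1" for i y
    using bij_betwE[OF bij[OF that]] fib[OF that] by blast
  have regE: "regular_section_at E y (s i)" if "y \<in> proj_space 1" "i \<le> n" for i y
  proof -
    have "openin (zariski_on 1 (proj_space 1)) (proj_space 1 :: 'k ppoint set)"
      using openin_topspace[of "zariski_on 1 (proj_space 1 :: 'k ppoint set)"] by simp
    moreover have "regular_at 1 (proj_space 1) y (\<lambda>_. 1)" if "y \<in> proj_space 1" for y :: "'k ppoint"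
      using regular_at_const that by blast
    moreover have "regular_section_at (twisting_bundle n 1) (f y) (coord_section i)"
      if "y \<in> proj_space 1" for y
      by (rule coord_section_regular) (use f that \<open>i \<le> n\<close> in auto)
    ultimately show ?thesis
      unfolding E_def pullback_def vbundle.select_convs using \<open>y \<in> proj_space 1\<close>
      by (intro exI[of _ "proj_space 1"] exI[of _ "1::nat"] exI[of _ "\<lambda>_ _. 1"]
        exI[of _ "\<lambda>_. coord_section i"] conjI) (simp_all add: s_def)
  qed
  define Q where "Q i P R \<longleftrightarrow>
    (\<forall>t. poly P t = \<phi> (proj_point (affine_vec t)) (s i (proj_point (affine_vec t))) (affine_vec t)) \<and>
    (\<forall>t. poly R t = \<phi> (proj_point (infinite_vec t)) (s i (proj_point (infinite_vec t))) (infinite_vec t)) \<and>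
    (\<forall>t. t \<noteq> 0 \<longrightarrow> poly P t = t powi (int e) * poly R (inverse t))" for i P R
  have "\<exists>P R. Q i P R" if "i \<le> n" for i
  proof -
    have r: "regular_section_at (twisting_bundle 1 (int e)) x (\<lambda>y. \<phi> y (s i y))"
      if "x \<in> proj_space 1" for x
      using reg[of "s i" x] fib regE[OF that \<open>i \<le> n\<close>] that by blast
    show ?thesis unfolding Q_def
      by (rule global_twisting_section[of "\<lambda>y. \<phi> y (s i y)" "int e", OF fib' r]) blast+
  qed
  then obtain F R where FR: "\<And>i. i \<le> n \<Longrightarrow> Q i (F i) (R i)" by metis
  have mem: "(\<lambda>i. if i \<le> n then \<phi> y (s i y) v else 0) \<in> f y" if y: "y \<in> proj_space 1" "v \<in> y" for y v
  proof -
    obtain u where u: "u \<in> f y" "f y = proj_point u" "u \<noteq> (\<lambda>_. 0)" "\<And>i. i > n \<Longrightarrow> u i = 0"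
      using proj_space_obtain[OF f[OF y(1)]] by blast
    then obtain j where j: "u j \<noteq> 0" by (auto simp: fun_eq_iff)
    \<comment> \<open>The fibre of O(1) is a line, so at \<open>f y\<close> all coordinate sections
      are multiples of the \<open>j\<close>-th one.\<close>
    have s_eq: "s i y = (\<lambda>a. u i / u j * s j y a)" for i
    proof
      fix a show "s i y a = u i / u j * s j y a"
        using j by (auto simp: s_def coord_section_def u(2) proj_point_def)
    qed
    have \<phi>_eq: "\<phi> y (s i y) v = u i / u j * \<phi> y (s j y) v" for i
      using scale[OF y(1) fib[OF y(1), of j], of "u i / u j"] s_eq[of i] by metis
    \<comment> \<open>By homogeneity, vanishing at one vector of the punctured line means vanishing
      as a fibre element, against injectivity.\<close>
    have "\<phi> y (s j y) v \<noteq> 0"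
    proof
      assume 0: "\<phi> y (s j y) v = 0"
      have "\<phi> y (s j y) b = 0" for b
      proof (cases "b \<in> y")
        case True
        have "y = proj_point v" using y by (rule proj_spaceD(1))
        with True obtain c where "b = (\<lambda>i. c * v i)" "c \<noteq> 0" unfolding proj_point_def by blast
        then show ?thesis using twisting_fibreD(1)[OF fib'[OF y(1), of j] y(2), of c] 0 by simp
      next
        case False
        then show ?thesis by (rule twisting_fibreD(2)[OF fib'[OF y(1)]])
      qed
      then have "\<phi> y (s j y) = \<phi> y (\<lambda>a. 0 * s j y a)"
        using scale[OF y(1) fib[OF y(1), of j], of 0] by auto
      moreover have "(\<lambda>a. 0 * s j y a) \<in> fibre E y"
        by (simp add: E_def pullback_def twisting_bundle_def)
      ultimately have "s j y = (\<lambda>a. 0 * s j y a)"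
        using bij_betw_imp_inj_on[OF bij[OF y(1)]] fib[OF y(1)] by (blast dest: inj_onD)
      then have "s j y u = 0" by (metis mult_zero_left)
      then show False using j u(1) by (simp add: s_def coord_section_def)
    qed
    then have "\<phi> y (s j y) v / u j \<noteq> 0" using j by simp
    moreover have "(\<lambda>i. if i \<le> n then \<phi> y (s i y) v else 0) = (\<lambda>i. \<phi> y (s j y) v / u j * u i)"
    proof
      fix i
      show "(if i \<le> n then \<phi> y (s i y) v else 0) = \<phi> y (s j y) v / u j * u i"
      proof (cases "i \<le> n")
        case True
        have "\<phi> y (s j y) v / u j * u i = u i / u j * \<phi> y (s j y) v" by simp
        then show ?thesis using True \<phi>_eq[of i] by presburger
      qed (simp add: u(4))
    qed
    ultimately show ?thesis using u(2) unfolding proj_point_def by blast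
  qed
  show ?thesis
  proof (rule that[of F R])
    fix t
    show "(\<lambda>i. if i \<le> n then poly (F i) t else 0) \<in> f (proj_point (affine_vec t))"
      using mem[OF chart_in_P1(1) self_in_proj_point, of t] FR unfolding Q_def by (simp cong: if_cong)
    show "(\<lambda>i. if i \<le> n then poly (R i) t else 0) \<in> f (proj_point (infinite_vec t))"
      using mem[OF chart_in_P1(2) self_in_proj_point, of t] FR unfolding Q_def by (simp cong: if_cong)
    show "poly (F i) t = t ^ e * poly (R i) (inverse t)" if "i \<le> n" "t \<noteq> 0" for i
    proof -
      have "poly (F i) t = t powi int e * poly (R i) (inverse t)"
        using FR[OF that(1)] that(2) unfolding Q_def by blast
      then show ?thesis by (simp only: power_int_of_nat)
    qed
  qed
qed

section \<open>Pairing vector fields with a cotangent field\<close>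

lemma tangent_spaceD:
  assumes "D \<in> tangent_space n X x"
  shows tangent_local: "\<And>g h U. regular_at n X x g \<Longrightarrow> openin (zariski_on n X) U \<Longrightarrow> x \<in> U \<Longrightarrow>
      (\<And>y. y \<in> U \<Longrightarrow> g y = h y) \<Longrightarrow> D g = D h"
    and tangent_cmult: "\<And>c g. regular_at n X x g \<Longrightarrow> D (\<lambda>y. c * g y) = c * D g"
    and tangent_add: "\<And>g h. regular_at n X x g \<Longrightarrow> regular_at n X x h \<Longrightarrow>
      D (\<lambda>y. g y + h y) = D g + D h"
    and tangent_mult: "\<And>g h. regular_at n X x g \<Longrightarrow> regular_at n X x h \<Longrightarrow>
      D (\<lambda>y. g y * h y) = g x * D h + h x * D g"
  using assms unfolding tangent_space_def by blast+

lemma tangent_const: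
  assumes "D \<in> tangent_space n X x" "x \<in> X" "x \<in> proj_space n"
  shows "D (\<lambda>y. c) = 0"
proof -
  have 1: "regular_at n X x (\<lambda>y. 1)" using assms by (intro regular_at_const)
  have "D (\<lambda>y. 1) = D (\<lambda>y. 1) + D (\<lambda>y. 1)"
    using tangent_mult[OF assms(1) 1 1] by (simp only: mult_1)
  then have "D (\<lambda>y. 1) = 0" by (simp only: add_cancel_right_right)
  then show ?thesis using tangent_cmult[OF assms(1) 1, of c] by simp
qed

lemma tangent_power:
  assumes "D \<in> tangent_space n X x" "regular_at n X x g"
  shows "D (\<lambda>y. g y ^ Suc k) = of_nat (Suc k) * g x ^ k * D g"
proof (induction k)
  case (Suc k)
  have "D (\<lambda>y. g y * g y ^ Suc k) = g x * D (\<lambda>y. g y ^ Suc k) + g x ^ Suc k * D g"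
    by (rule tangent_mult[OF assms regular_at_power[OF assms(2)]])
  then show ?case using Suc.IH by (simp add: algebra_simps)
qed simp

lemma tangent_sum:
  assumes "D \<in> tangent_space n X x" "x \<in> X" "x \<in> proj_space n"
    and "\<And>i. i \<in> I \<Longrightarrow> regular_at n X x (g i)"
  shows "D (\<lambda>y. \<Sum>i\<in>I. g i y) = (\<Sum>i\<in>I. D (g i))"
  using assms(4)
proof (induction I rule: infinite_finite_induct)
  case (insert i I)
  have "D (\<lambda>y. g i y + (\<Sum>i\<in>I. g i y)) = D (g i) + D (\<lambda>y. \<Sum>i\<in>I. g i y)"
    by (rule tangent_add[OF assms(1)]) (use insert.prems assms in \<open>auto intro: regular_at_sum\<close>)
  then show ?case using insert by simp
qed (use tangent_const[OF assms(1-3)] in auto)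

lemma coord_ratio_regular:
  assumes "proj_point v \<in> X" "proj_point v \<in> proj_space n" "i \<le> n" "j \<le> n" "v j \<noteq> 0"
  shows "regular_at n X (proj_point v) (coord_ratio i j)"
proof -
  have "\<forall>u\<in>proj_point v. u j \<noteq> 0" using assms(5) unfolding proj_point_def by auto
  then show ?thesis
    unfolding regular_at_iff using assms(1,2) local_quotient_coord_ratio[OF assms(3,4)] by blast
qed

lemma openin_coord_nonzero:
  fixes X :: "'k::field ppoint set"
  assumes "j \<le> n"
  shows "openin (zariski_on n X) {y \<in> X \<inter> proj_space n. \<forall>u\<in>y. u j \<noteq> 0}"
  by (rule openin_zariski_on_nonvanishing[OF form_coord[OF assms]])

lemma in_coord_nonzero:
  fixes v :: "nat \<Rightarrow> 'k::field"
  assumes "proj_point v \<in> X" "proj_point v \<in> proj_space n" "v j \<noteq> 0"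
  shows "proj_point v \<in> {y \<in> X \<inter> proj_space n. \<forall>u\<in>y. u j \<noteq> 0}"
  using assms unfolding proj_point_def by auto

text \<open>Differentiate the dehomogenised equation: the exponent \<open>q + 1\<close> counts as 1
  in the field, so only \<open>q\<close>-th powers of the coordinates remain as
  coefficients.\<close>

lemma fermat_tangent_equation:
  fixes v :: "nat \<Rightarrow> 'k::field"
  assumes q: "of_nat q = (0::'k)" and d: "d = q + 1"
    and x: "proj_point v \<in> fermat_hypersurface d" and j: "j \<le> d" "v j \<noteq> 0"
    and D: "D \<in> tangent_space d (fermat_hypersurface d) (proj_point v)"
  shows "(\<Sum>i\<le>d. v i ^ q * D (coord_ratio i j)) = 0"
proof -
  let ?X = "fermat_hypersurface d" and ?x = "proj_point v"
  have xP: "?x \<in> proj_space d" using x fermat_subset_proj_space by blast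
  have reg: "regular_at d ?X ?x (coord_ratio i j)" if "i \<le> d" for i
    using coord_ratio_regular[OF x xP that j] .
  have "D (\<lambda>y. \<Sum>i\<le>d. coord_ratio i j y ^ Suc q) = D (\<lambda>y. 0)"
  proof (rule tangent_local[OF D])
    show "regular_at d ?X ?x (\<lambda>y. \<Sum>i\<le>d. coord_ratio i j y ^ Suc q)"
      by (rule regular_at_sum[OF regular_at_power[OF reg] x xP]) simp
    show "openin (zariski_on d ?X) {y \<in> ?X \<inter> proj_space d. \<forall>u\<in>y. u j \<noteq> 0}"
      by (rule openin_coord_nonzero) fact
    show "?x \<in> {y \<in> ?X \<inter> proj_space d. \<forall>u\<in>y. u j \<noteq> 0}"
      by (rule in_coord_nonzero) fact+
    fix y :: "'k ppoint" assume y: "y \<in> {y \<in> ?X \<inter> proj_space d. \<forall>u\<in>y. u j \<noteq> 0}"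
    then obtain u where u: "u \<in> y" "y = proj_point u" by (auto elim: proj_space_obtain)
    then have "(\<Sum>i\<le>d. u i ^ Suc q) = 0" "u j \<noteq> 0"
      using y d unfolding fermat_hypersurface_def by auto
    then show "(\<Sum>i\<le>d. coord_ratio i j y ^ Suc q) = 0"
      unfolding u(2) coord_ratio_proj_point power_divide sum_divide_distrib[symmetric] by simp
  qed
  also have "\<dots> = 0" by (rule tangent_const[OF D x xP])
  also have "D (\<lambda>y. \<Sum>i\<le>d. coord_ratio i j y ^ Suc q) = (\<Sum>i\<le>d. D (\<lambda>y. coord_ratio i j y ^ Suc q))"
    by (rule tangent_sum[OF D x xP]) (use reg regular_at_power in blast)
  also have "\<dots> = (\<Sum>i\<le>d. (v i / v j) ^ q * D (coord_ratio i j))"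
    by (intro sum.cong refl, subst tangent_power[OF D reg])
      (use q in \<open>simp_all add: coord_ratio_proj_point\<close>)
  also have "\<dots> = (\<Sum>i\<le>d. v i ^ q * D (coord_ratio i j)) / v j ^ q"
    by (simp add: power_divide sum_divide_distrib)
  finally show ?thesis using j by simp
qed

text \<open>The entries \<open>v j * D (coord_ratio i j)\<close>, with \<open>j\<close> fixed, lift
  \<open>D\<close> to the ambient vector space. The product rule for the ratio \<open>i / l\<close>
  as \<open>i / j\<close> times \<open>j / l\<close> shows that another chart changes the lift by a
  multiple of \<open>v\<close>.\<close>

lemma tangent_change_chart:
  fixes v :: "nat \<Rightarrow> 'k::field"
  assumes x: "proj_point v \<in> X" "proj_point v \<in> proj_space n"
    and D: "D \<in> tangent_space n X (proj_point v)"
    and ij: "i \<le> n" "j \<le> n" "v j \<noteq> 0" "l \<le> n" "v l \<noteq> 0"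
  shows "v l * D (coord_ratio i l) = v l / v j * D (coord_ratio j l) * v i + v j * D (coord_ratio i j)"
proof -
  have r: "regular_at n X (proj_point v) (coord_ratio i l)" "regular_at n X (proj_point v) (coord_ratio i j)"
    "regular_at n X (proj_point v) (coord_ratio j l)"
    by (rule coord_ratio_regular[OF x]; fact)+
  have "D (coord_ratio i l) = D (\<lambda>y. coord_ratio i j y * coord_ratio j l y)"
  proof (rule tangent_local[OF D r(1)])
    show "openin (zariski_on n X) {y \<in> X \<inter> proj_space n. \<forall>u\<in>y. u j \<noteq> 0}"
      by (rule openin_coord_nonzero) fact
    show "proj_point v \<in> {y \<in> X \<inter> proj_space n. \<forall>u\<in>y. u j \<noteq> 0}"
      by (rule in_coord_nonzero) fact+
    fix y :: "'k ppoint" assume y: "y \<in> {y \<in> X \<inter> proj_space n. \<forall>u\<in>y. u j \<noteq> 0}"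
    then obtain u where u: "u \<in> y" "y = proj_point u" by (auto elim: proj_space_obtain)
    then have "u j \<noteq> 0" using y by auto
    then show "coord_ratio i l y = coord_ratio i j y * coord_ratio j l y"
      unfolding u(2) coord_ratio_proj_point by simp
  qed
  also have "\<dots> = v i / v j * D (coord_ratio j l) + v j / v l * D (coord_ratio i j)"
    using tangent_mult[OF D r(2,3)] by (simp add: coord_ratio_proj_point)
  finally show ?thesis using ij by (simp add: field_simps)
qed

text \<open>Near the point, \<open>s\<close> is a combination of the fields
  \<open>\<sigma> i\<close> along \<open>f\<close>. Each sends \<open>g\<close> to a function
  regular at the image point, and composing with the morphism keeps it regular.\<close>

lemma pulled_back_field_rational:
  fixes f :: "'k::field ppoint \<Rightarrow> 'k ppoint"
  assumes f: "variety_morphism 1 (proj_space 1) n X f"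
    and s: "regular_section_at (pullback 1 (proj_space 1) f (tangent_bundle n X)) (proj_point (line v w t0)) s"
    and vw: "\<And>t. proj_point (line v w t) \<in> proj_space 1"
    and g: "regular_at n X (f (proj_point (line v w t0))) g"
  shows "rational_at t0 (\<lambda>t. s (proj_point (line v w t)) g)"
proof -
  let ?x = "proj_point (line v w t0)"
  from s obtain U and N :: nat and h \<sigma> where U: "openin (zariski_on 1 (proj_space 1)) U" "?x \<in> U"
    and hs: "\<forall>i<N. \<forall>y\<in>U. regular_at 1 (proj_space 1) y (h i) \<and>
        regular_section_at (tangent_bundle n X) (f y) (\<sigma> i)"
    and s_eq: "\<forall>y\<in>U. s y = (\<lambda>a. \<Sum>i<N. h i y * \<sigma> i (f y) a)"
    unfolding pullback_def vbundle.select_convs by (elim exE conjE)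
  obtain m L where L: "form 1 m L" "\<forall>v\<in>?x. L v \<noteq> 0"
    "\<And>y. y \<in> proj_space 1 \<Longrightarrow> y \<in> proj_space 1 \<Longrightarrow> \<forall>v\<in>y. L v \<noteq> 0 \<Longrightarrow> y \<in> U"
    using openin_zariski_on_basic[OF U] by blast
  obtain P where P: "\<And>t. poly P t = L (line v w t)"
    using form_along_line[OF L(1), where v = v and w = w] by blast
  have "rational_at t0 (\<lambda>t. h i (proj_point (line v w t)) * \<sigma> i (f (proj_point (line v w t))) g)"
    if i: "i < N" for i
  proof (rule rational_at_mult)
    show "rational_at t0 (\<lambda>t. h i (proj_point (line v w t)))"
      by (rule regular_at_rational[of 1 "proj_space 1"]) (use hs U(2) i vw in auto)
    have "regular_section_at (tangent_bundle n X) (f ?x) (\<sigma> i)" using hs U(2) i by blast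
    then have "regular_at n X (f ?x) (\<lambda>z. \<sigma> i z g)"
      using g unfolding tangent_bundle_def vbundle.select_convs by blast
    then have "regular_at 1 (proj_space 1) ?x ((\<lambda>z. \<sigma> i z g) \<circ> f)"
      using f vw unfolding variety_morphism_def by blast
    then have "rational_at t0 (\<lambda>t. ((\<lambda>z. \<sigma> i z g) \<circ> f) (proj_point (line v w t)))"
      by (rule regular_at_rational) (use vw in auto)
    then show "rational_at t0 (\<lambda>t. \<sigma> i (f (proj_point (line v w t))) g)" by simp
  qed
  then have "rational_at t0 (\<lambda>t. \<Sum>i\<in>{..<N}. h i (proj_point (line v w t)) * \<sigma> i (f (proj_point (line v w t))) g)"
    by (intro rational_at_sum) simp
  then show ?thesis
  proof (rule rational_at_cong[where L = P])
    show "poly P t0 \<noteq> 0" unfolding P using L(2) self_in_proj_point by blast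
    fix t assume "poly P t \<noteq> 0"
    then have "\<forall>u\<in>proj_point (line v w t). L u \<noteq> 0"
      unfolding form_nonzero_on_point[OF L(1)] P .
    then have "proj_point (line v w t) \<in> U" using L(3) vw by blast
    then show "(\<Sum>i\<in>{..<N}. h i (proj_point (line v w t)) * \<sigma> i (f (proj_point (line v w t))) g)
        = s (proj_point (line v w t)) g"
      using s_eq by simp
  qed
qed

text \<open>
  \<open>C\<close> is a cotangent field along the curve: as \<open>\<Sum>C\<^sub>i V\<^sub>i = 0\<close>, its pairing with a vector field
  does not depend on the chart \<open>X\<^sub>j \<noteq> 0\<close> in which the vector field is expressed.
\<close>

lemma pairing_polynomial:
  fixes f :: "'k::alg_closed_field ppoint \<Rightarrow> 'k ppoint" and C V :: "nat \<Rightarrow> 'k poly"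
  assumes f: "variety_morphism 1 (proj_space 1) n X f"
    and fX: "\<And>y. y \<in> proj_space 1 \<Longrightarrow> f y \<in> X \<inter> proj_space n"
    and s: "\<And>y. y \<in> proj_space 1 \<Longrightarrow>
       regular_section_at (pullback 1 (proj_space 1) f (tangent_bundle n X)) y s"
      "\<And>y. y \<in> proj_space 1 \<Longrightarrow> s y \<in> tangent_space n X (f y)"
    and vw: "\<And>t. proj_point (line v w t) \<in> proj_space 1"
    and V: "\<And>t. (\<lambda>i. if i \<le> n then poly (V i) t else 0) \<in> f (proj_point (line v w t))"
    and CV: "(\<Sum>i\<le>n. C i * V i) = 0"
  obtains P where "\<And>t j. j \<le> n \<Longrightarrow> poly (V j) t \<noteq> 0 \<Longrightarrow>
    poly P t = (\<Sum>i\<le>n. poly (C i) t * (poly (V j) t * s (proj_point (line v w t)) (coord_ratio i j)))"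
proof -
  define u where "u t = (\<lambda>i. if i \<le> n then poly (V i) t else 0)" for t
  define y where "y t = proj_point (line v w t)" for t
  have yP: "y t \<in> proj_space 1" for t unfolding y_def by (rule vw)
  have fy: "f (y t) = proj_point (u t)" and u0: "u t \<noteq> (\<lambda>_. 0)" for t
    using proj_spaceD(1,2)[of "f (y t)" n "u t"] fX[OF yP[of t]] V[of t] by (auto simp: u_def y_def)
  define val where "val j t = (\<Sum>i\<le>n. poly (C i) t * (poly (V j) t * s (y t) (coord_ratio i j)))" for j t
  have pt: "proj_point (u t) \<in> X" "proj_point (u t) \<in> proj_space n" for t
    using fX[OF yP[of t]] by (auto simp: fy)
  have CV': "(\<Sum>i\<le>n. poly (C i) t * u t i) = 0" for t
    using arg_cong[OF CV, of "\<lambda>p. poly p t"] by (simp add: poly_sum u_def)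
  \<comment> \<open>Two chart lifts differ by a multiple of \<open>u t\<close>, which
    \<open>CV'\<close> kills.\<close>
  have indep: "val l t = val j t"
    if "j \<le> n" "poly (V j) t \<noteq> 0" "l \<le> n" "poly (V l) t \<noteq> 0" for j l t
  proof -
    have sT: "s (y t) \<in> tangent_space n X (proj_point (u t))" using s(2)[OF yP] by (simp add: fy)
    have uj: "u t j = poly (V j) t" "u t l = poly (V l) t" using that by (auto simp: u_def)
    have "poly (C i) t * (poly (V l) t * s (y t) (coord_ratio i l))
        = (u t l / u t j * s (y t) (coord_ratio j l)) * (poly (C i) t * u t i)
        + poly (C i) t * (poly (V j) t * s (y t) (coord_ratio i j))" if "i \<le> n" for i
      using tangent_change_chart[OF pt sT, of i j l] that \<open>j \<le> n\<close> \<open>l \<le> n\<close>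
        \<open>poly (V j) t \<noteq> 0\<close> \<open>poly (V l) t \<noteq> 0\<close>
      unfolding uj by (simp add: algebra_simps)
    then have "val l t = (\<Sum>i\<le>n. (u t l / u t j * s (y t) (coord_ratio j l)) * (poly (C i) t * u t i)
        + poly (C i) t * (poly (V j) t * s (y t) (coord_ratio i j)))"
      unfolding val_def by (intro sum.cong refl) simp
    also have "\<dots> = val j t"
      unfolding sum.distrib sum_distrib_left[symmetric] CV' val_def by simp
    finally show ?thesis .
  qed
  have "\<exists>j\<le>n. poly (V j) t \<noteq> 0" for t
  proof (rule ccontr)
    assume "\<not> ?thesis"
    then have "u t = (\<lambda>_. 0)" by (auto simp: u_def fun_eq_iff)
    then show False using u0 by simp
  qed
  then obtain J where J: "\<And>t. J t \<le> n \<and> poly (V (J t)) t \<noteq> 0" by metis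
  \<comment> \<open>The index \<open>J t\<close> may jump, but near \<open>t0\<close> the fixed
    chart \<open>J t0\<close> stays valid and gives the same value.\<close>
  have "rational_at t0 (\<lambda>t. val (J t) t)" for t0
  proof (rule rational_at_cong[where L = "V (J t0)" and a = "val (J t0)"])
    show "rational_at t0 (val (J t0))"
      unfolding val_def
    proof (intro rational_at_sum rational_at_mult rational_at_poly)
      fix i assume "i \<in> {..n}"
      then show "rational_at t0 (\<lambda>t. s (y t) (coord_ratio i (J t0)))"
        unfolding y_def
        by (intro pulled_back_field_rational[OF f s(1) vw] vw)
          (use J[of t0] coord_ratio_regular[OF pt, of i "J t0" t0] in
            \<open>auto simp: fy[unfolded y_def] u_def\<close>)
    qed
  qed (use J indep in auto)
  then obtain P where P: "\<And>t. val (J t) t = poly P t" by (rule rational_everywhere_imp_poly) blast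
  show ?thesis
  proof (rule that[of P])
    fix t j assume "j \<le> n" "poly (V j) t \<noteq> 0"
    then have "poly P t = val j t" using indep[of j t "J t"] J P by simp
    then show "poly P t = (\<Sum>i\<le>n. poly (C i) t * (poly (V j) t * s (proj_point (line v w t)) (coord_ratio i j)))"
      by (simp add: val_def y_def)
  qed
qed

section \<open>Very free curves of degree q(q - 1)\<close>

text \<open>
  The section is \<open>c i * X\<^sub>0 ^ a i\<close> in the \<open>i\<close>-th summand; positivity of \<open>a i\<close> makes it vanish at
  infinity.
\<close>

lemma ample_section:
  fixes E :: "('k::field, 'a) vbundle"
  assumes ample: "ample_on_P1 E" and D: "D \<in> fibre E (proj_point (affine_vec t0))"
    and zero: "\<And>y. y \<in> proj_space 1 \<Longrightarrow> (\<lambda>_. 0) \<in> fibre E y"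
  obtains s where "\<And>y. y \<in> proj_space 1 \<Longrightarrow> s y \<in> fibre E y"
    "\<And>y. y \<in> proj_space 1 \<Longrightarrow> regular_section_at E y s"
    "s (proj_point (affine_vec t0)) = D" "s (proj_point (infinite_vec 0)) = (\<lambda>_. 0)"
proof -
  from ample obtain N :: nat and a :: "nat \<Rightarrow> int" where a: "\<forall>i<N. a i > 0"
    and iso: "bundle_iso (proj_space 1) E (direct_sum 1 (proj_space 1) N (\<lambda>i. twisting_bundle 1 (a i)))"
    unfolding ample_on_P1_def by blast
  define E' :: "('k, nat \<times> (nat \<Rightarrow> 'k)) vbundle" where
    "E' = direct_sum 1 (proj_space 1) N (\<lambda>i. twisting_bundle 1 (a i))"
  obtain \<phi> :: "'k ppoint \<Rightarrow> ('a \<Rightarrow> 'k) \<Rightarrow> (nat \<times> (nat \<Rightarrow> 'k) \<Rightarrow> 'k)" where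
    bij: "\<And>x. x \<in> proj_space 1 \<Longrightarrow> bij_betw (\<phi> x) (fibre E x) (fibre E' x)" and
    scale: "\<And>x c u. x \<in> proj_space 1 \<Longrightarrow> u \<in> fibre E x \<Longrightarrow> \<phi> x (\<lambda>a. c * u a) = (\<lambda>b. c * \<phi> x u b)" and
    reg: "\<And>s x. (\<And>x. x \<in> proj_space 1 \<Longrightarrow> s x \<in> fibre E x) \<Longrightarrow> x \<in> proj_space 1 \<Longrightarrow>
       regular_section_at E x s \<longleftrightarrow> regular_section_at E' x (\<lambda>y. \<phi> y (s y))"
    using bundle_isoE[OF iso] unfolding E'_def by blast
  define y0 where "y0 = proj_point (affine_vec t0)"
  define y1 where "y1 = proj_point (infinite_vec (0::'k))"
  have yP: "y0 \<in> proj_space 1" "y1 \<in> proj_space 1"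
    unfolding y0_def y1_def by (rule chart_in_P1)+
  define h where "h = \<phi> y0 D"
  have hE: "h \<in> fibre E' y0"
    using bij_betwE[OF bij[OF yP(1)]] D unfolding h_def y0_def by blast
  then have h_fib: "\<And>i. i < N \<Longrightarrow> (\<lambda>v. h (i, v)) \<in> fibre (twisting_bundle 1 (a i)) y0"
    and h0: "\<And>i v. i \<ge> N \<Longrightarrow> h (i, v) = 0"
    unfolding E'_def direct_sum_def by auto
  \<comment> \<open>The vector \<open>affine_vec t0\<close> has coordinate 0 equal to 1, so the
    coefficient \<open>h (i, affine_vec t0)\<close> makes the section equal to \<open>h\<close> over
    \<open>y0\<close>.\<close>
  define S where "S y = (\<lambda>(i, v). if i < N \<and> v \<in> y then h (i, affine_vec t0) * v 0 ^ nat (a i) else 0)"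
    for y :: "'k ppoint"
  have SE: "S y \<in> fibre E' y" if y: "y \<in> proj_space 1" for y
  proof -
    have "c powi a i = c ^ nat (a i)" if "i < N" for i and c :: 'k
    proof -
      have "0 < a i" using a that by blast
      then show ?thesis by (simp add: power_int_def)
    qed
    then show ?thesis
      unfolding E'_def direct_sum_def twisting_bundle_def vbundle.select_convs
      by (auto simp: S_def power_mult_distrib proj_point_cmult[OF y])
  qed
  define s where "s y = inv_into (fibre E y) (\<phi> y) (S y)" for y
  have im: "S y \<in> \<phi> y ` fibre E y" if "y \<in> proj_space 1" for y
    using bij_betw_imp_surj_on[OF bij[OF that]] SE[OF that] by simp
  have sE: "s y \<in> fibre E y" if "y \<in> proj_space 1" for y
    unfolding s_def by (rule inv_into_into[OF im[OF that]])
  have \<phi>s: "\<phi> y (s y) = S y" if "y \<in> proj_space 1" for y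
    unfolding s_def by (rule f_inv_into_f[OF im[OF that]])
  have inj: "u = u'" if "y \<in> proj_space 1" "u \<in> fibre E y" "u' \<in> fibre E y" "\<phi> y u = \<phi> y u'" for y u u'
    using bij_betw_imp_inj_on[OF bij[OF that(1)]] that(2-4) by (blast dest: inj_onD)
  have regS: "regular_section_at E' y (\<lambda>y. \<phi> y (s y))" if y: "y \<in> proj_space 1" for y
  proof -
    have U: "openin (zariski 1) (proj_space 1 :: 'k ppoint set)"
      using openin_topspace[of "zariski 1 :: 'k ppoint topology"] by simp
    then have U': "openin (zariski_on 1 (proj_space 1)) (proj_space 1 :: 'k ppoint set)"
      using openin_topspace[of "zariski_on 1 (proj_space 1) :: 'k ppoint topology"] by simp
    have "regular_section_at (twisting_bundle 1 (a i)) y (\<lambda>y v. \<phi> y (s y) (i, v))" if "i < N" for i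
    proof -
      have "form 1 (nat (a i)) (\<lambda>v :: nat \<Rightarrow> 'k. h (i, affine_vec t0) * v 0 ^ nat (a i))"
        using form_cmult[OF form_power[OF form_coord[of 0 1]]] by simp
      moreover have "int (nat (a i)) - int 0 = a i" using a[rule_format, OF that] by simp
      moreover have "(\<forall>v\<in>y. (1::'k) \<noteq> 0) \<and> (\<lambda>v. \<phi> y (s y) (i, v)) =
          (\<lambda>v. if v \<in> y then h (i, affine_vec t0) * v 0 ^ nat (a i) / 1 else 0)"
        if "y \<in> proj_space 1" for y
        unfolding \<phi>s[OF that] using \<open>i < N\<close> by (simp add: S_def cong: if_cong)
      ultimately show ?thesis
        unfolding twisting_bundle_def vbundle.select_convs using U y form_const[of 1 "1::'k"]
        by blast
    qed
    moreover have "\<forall>y\<in>proj_space 1. \<forall>i\<ge>N. \<forall>v. \<phi> y (s y) (i, v) = 0"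
      by (simp add: \<phi>s S_def)
    ultimately show ?thesis
      unfolding E'_def direct_sum_def vbundle.select_convs using U' y by blast
  qed
  show ?thesis
  proof (rule that[of s])
    show "s y \<in> fibre E y" if "y \<in> proj_space 1" for y by (rule sE[OF that])
    show "regular_section_at E y s" if "y \<in> proj_space 1" for y
      using reg[of s y] sE regS[OF that] that by blast
    have "S y0 = h"
    proof
      fix b :: "nat \<times> (nat \<Rightarrow> 'k)"
      obtain i v where b: "b = (i, v)" by (cases b)
      show "S y0 b = h b"
      proof (cases "i < N \<and> v \<in> y0")
        case True
        then obtain c where c: "v = (\<lambda>j. c * affine_vec t0 j)" "c \<noteq> 0"
          unfolding y0_def proj_point_def by blast
        have "h (i, v) = c powi a i * h (i, affine_vec t0)"
          unfolding c(1) using True c(2)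
          by (intro twisting_fibreD(1)[OF h_fib]) (auto simp: y0_def self_in_proj_point)
        moreover have "0 < a i" using a True by blast
        then have "c powi a i = c ^ nat (a i)" by (simp add: power_int_def)
        moreover have "v 0 = c" by (simp add: c(1) line_def unit_vec_def)
        ultimately show ?thesis using True by (simp add: b S_def)
      next
        case False
        then show ?thesis using h0[of i v] twisting_fibreD(2)[OF h_fib, of i v]
          by (cases "i < N") (auto simp: b S_def)
      qed
    qed
    then have "s y0 = D"
      using inj[OF yP(1) sE[OF yP(1)], of D] D \<phi>s[OF yP(1)] by (simp add: h_def y0_def)
    then show "s (proj_point (affine_vec t0)) = D" by (simp add: y0_def)
    have "S y1 = (\<lambda>_. 0)"
    proof
      fix b :: "nat \<times> (nat \<Rightarrow> 'k)"
      obtain i v where b: "b = (i, v)" by (cases b)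
      have "v 0 = 0" if "v \<in> y1"
        using that unfolding y1_def proj_point_def by (auto simp: unit_vec_def)
      then show "S y1 b = 0" using a by (auto simp: b S_def)
    qed
    moreover have "\<phi> y1 (\<lambda>_. 0) = (\<lambda>_. 0)" using scale[OF yP(2) zero[OF yP(2)], of 0] by simp
    ultimately have "s y1 = (\<lambda>_. 0)"
      using inj[OF yP(2) sE[OF yP(2)] zero[OF yP(2)]] \<phi>s[OF yP(2)] by simp
    then show "s (proj_point (infinite_vec 0)) = (\<lambda>_. 0)" by (simp add: y1_def)
  qed
qed

lemma zero_in_tangent_space: "(\<lambda>_. 0) \<in> tangent_space n X x"
  unfolding tangent_space_def by simp

lemma fermat_not_very_free:
  fixes f :: "'k::alg_closed_field ppoint \<Rightarrow> 'k ppoint"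
  assumes q: "q = CHAR('k) ^ r" "prime CHAR('k)" "r \<ge> 1" and d: "d = q + 1"
    and curve: "rational_curve d (fermat_hypersurface d) f"
    and deg: "curve_degree d f (int (q * (q - 1)))"
    and free: "very_free d (fermat_hypersurface d) f"
  shows False
proof -
  define X :: "'k ppoint set" where "X = fermat_hypersurface d"
  define e m where "e = q * (q - 1)" and "m = q - 1"
  have "CHAR('k) dvd q" using q(1,3) by (simp add: dvd_power)
  then have q0: "of_nat q = (0::'k)" by (simp add: of_nat_eq_0_iff_char_dvd)
  have "CHAR('k) \<ge> 2" using q(2) prime_ge_2_nat by blast
  then have q2: "q \<ge> 2" using q(1,3) self_le_power[of "CHAR('k)" r] by linarith
  then have qpos: "q > 0" by simp
  have frob: "(x + y) ^ q = x ^ q + y ^ q" for x y :: 'k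
    using freshmans_dream'[where ?'a = 'k and n = r] q(1,2) by blast
  have f: "variety_morphism 1 (proj_space 1) d X f"
    using curve unfolding rational_curve_def X_def .
  have fX: "f y \<in> X \<inter> proj_space d" if "y \<in> proj_space 1" for y
  proof -
    have "continuous_map (zariski_on 1 (proj_space 1)) (zariski_on d X) f"
      using f unfolding variety_morphism_def by blast
    then have "f y \<in> topspace (zariski_on d X)" using that unfolding continuous_map_def by auto
    then show ?thesis by auto
  qed
  obtain F R where
    F: "\<And>t. (\<lambda>i. if i \<le> d then poly (F i) t else 0) \<in> f (proj_point (affine_vec t))" and
    R: "\<And>t. (\<lambda>i. if i \<le> d then poly (R i) t else 0) \<in> f (proj_point (infinite_vec t))" and
    FR: "\<And>i t. i \<le> d \<Longrightarrow> t \<noteq> 0 \<Longrightarrow> poly (F i) t = t ^ e * poly (R i) (inverse t)"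
    using curve_polynomials[of f d e] fX deg unfolding e_def by blast
  define u where "u t = (\<lambda>i. if i \<le> d then poly (F i) t else 0)" for t
  have u: "f (proj_point (affine_vec t)) = proj_point (u t)" "u t \<noteq> (\<lambda>_. 0)"
    "\<And>i. i > d \<Longrightarrow> u t i = 0" for t
  proof -
    have 1: "f (proj_point (affine_vec t)) \<in> proj_space d" using fX[OF chart_in_P1(1)] by blast
    have 2: "u t \<in> f (proj_point (affine_vec t))" unfolding u_def by (rule F)
    show "f (proj_point (affine_vec t)) = proj_point (u t)" "u t \<noteq> (\<lambda>_. 0)"
      "\<And>i. i > d \<Longrightarrow> u t i = 0"
      using proj_spaceD[OF 1 2] by blast+
  qed
  have uX: "proj_point (u t) \<in> fermat_hypersurface d" for t
    using fX[OF chart_in_P1(1), of t] u(1)[of t] unfolding X_def by simp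
  have nzF: "\<exists>i\<le>d. poly (F i) t \<noteq> 0" for t
    using u(2)[of t] by (auto simp: u_def fun_eq_iff split: if_splits)
  \<comment> \<open>The forms have no common zero at infinity; in terms of polynomials, some
    \<open>F i\<close> attains the full degree \<open>e\<close>.\<close>
  have "(\<lambda>i. if i \<le> d then poly (R i) 0 else 0) \<noteq> (\<lambda>_. 0)"
    using proj_spaceD(2)[OF _ R[of 0]] fX[OF chart_in_P1(2)] by blast
  then obtain i0 where i0: "i0 \<le> d" "poly (R i0) 0 \<noteq> 0" by (auto simp: fun_eq_iff split: if_splits)
  have degF: "degree (F i) \<le> e" if "i \<le> d" for i
    by (rule degree_le_if_reversible(1)[OF FR[OF that]])
  have infF: "\<exists>i\<le>d. degree (F i) = e"
    using degree_le_if_reversible(2)[OF FR[OF i0(1)] i0(2)] i0(1) by blast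
  have fermat: "(\<Sum>i\<le>d. F i ^ (q + 1)) = 0"
  proof (rule poly_eqI_cofinite)
    have "poly (\<Sum>i\<le>d. F i ^ (q + 1)) t = 0" for t
    proof -
      have "(\<Sum>i\<le>d. u t i ^ d) = 0" using fermat_point_iff[OF u(2,3)] uX by blast
      moreover have "(\<Sum>i\<le>d. u t i ^ d) = poly (\<Sum>i\<le>d. F i ^ (q + 1)) t"
        unfolding poly_sum poly_power d by (intro sum.cong) (auto simp: u_def d)
      ultimately show ?thesis by simp
    qed
    then show "finite {t. poly (\<Sum>i\<le>d. F i ^ (q + 1)) t \<noteq> poly 0 t}" by simp
  qed
  obtain G A B where GAB: "\<And>i. i \<le> d \<Longrightarrow> G * F i = monom 1 (m + e) * A i + B i"
    and degB: "\<And>i. i \<le> d \<Longrightarrow> degree (B i) \<le> e"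
    and AF: "(\<Sum>i\<le>d. A i ^ q * F i) = 0" and BF: "(\<Sum>i\<le>d. B i ^ q * F i) = 0"
    and nonprop: "\<exists>i\<le>d. \<exists>j\<le>d. A i * F j \<noteq> A j * F i"
    using frobenius_cotangent_section[OF q(1,2) q2 m_def e_def d degF nzF infF fermat] by blast
  \<comment> \<open>\<open>B'\<close> is \<open>B\<close> in the coordinate at infinity; the entries
    \<open>- (B' i ^ q)\<close> will be the cotangent field on the second chart.\<close>
  have "\<exists>B'. i \<le> d \<longrightarrow> (\<forall>z. z \<noteq> 0 \<longrightarrow> poly B' z = z ^ e * poly (B i) (inverse z))" for i
    using reversal_exists[OF degB, of i] by blast
  then obtain B' where B': "\<And>i z. i \<le> d \<Longrightarrow> z \<noteq> 0 \<Longrightarrow> poly (B' i) z = z ^ e * poly (B i) (inverse z)"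
    by metis
  have eq: "q * (m + e) = e + e * q" by (simp add: e_def m_def algebra_simps)
  have RF: "poly (R i) z = z ^ e * poly (F i) (inverse z)" if "i \<le> d" "z \<noteq> 0" for i z
    using FR[of i "inverse z"] that by (simp add: power_inverse[symmetric] field_simps)
  have B'R: "(\<Sum>i\<le>d. - (B' i ^ q) * R i) = 0"
  proof (rule poly_eqI_cofinite, rule finite_subset)
    have "poly (\<Sum>i\<le>d. - (B' i ^ q) * R i) z = 0" if "z \<noteq> 0" for z
    proof -
      have "poly (\<Sum>i\<le>d. - (B' i ^ q) * R i) z
          = (\<Sum>i\<le>d. - (z ^ (e * q + e)) * (poly (B i) (inverse z) ^ q * poly (F i) (inverse z)))"
        unfolding poly_sum
        by (intro sum.cong refl) (simp add: B' RF that power_mult_distrib power_add power_mult)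
      also have "\<dots> = - (z ^ (e * q + e)) * poly (\<Sum>i\<le>d. B i ^ q * F i) (inverse z)"
        by (simp add: poly_sum sum_distrib_left)
      also have "\<dots> = 0" unfolding BF by simp
      finally show ?thesis .
    qed
    then show "{z. poly (\<Sum>i\<le>d. - (B' i ^ q) * R i) z \<noteq> poly 0 z} \<subseteq> {0}" by auto
  qed simp
  have pairing: "(\<Sum>i\<le>d. poly (A i) t0 ^ q * (poly (F j) t0 * D (coord_ratio i j))) = 0"
    if D: "D \<in> tangent_space d X (proj_point (u t0))" and j: "j \<le> d" "poly (F j) t0 \<noteq> 0" for D t0 j
  proof -
    let ?E = "pullback 1 (proj_space 1) f (tangent_bundle d X)"
    have fib: "fibre ?E y = tangent_space d X (f y)" for y
      unfolding pullback_def tangent_bundle_def by simp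
    obtain s where s: "\<And>y. y \<in> proj_space 1 \<Longrightarrow> s y \<in> tangent_space d X (f y)"
      "\<And>y. y \<in> proj_space 1 \<Longrightarrow> regular_section_at ?E y s"
      "s (proj_point (affine_vec t0)) = D" "s (proj_point (infinite_vec 0)) = (\<lambda>_. 0)"
    proof (rule ample_section[of ?E D t0])
      show "ample_on_P1 ?E" using free unfolding very_free_def X_def .
      show "D \<in> fibre ?E (proj_point (affine_vec t0))" using D unfolding fib u(1) .
      show "(\<lambda>_. 0) \<in> fibre ?E y" for y unfolding fib by (rule zero_in_tangent_space)
    qed (use fib in auto)
    have CA: "(\<Sum>i\<le>d. (A i ^ q) * F i) = 0" using AF by simp
    obtain P where P: "\<And>t j. j \<le> d \<Longrightarrow> poly (F j) t \<noteq> 0 \<Longrightarrow> poly P t =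
        (\<Sum>i\<le>d. poly (A i ^ q) t * (poly (F j) t * s (proj_point (affine_vec t)) (coord_ratio i j)))"
      using pairing_polynomial[OF f fX s(2,1) chart_in_P1(1) F CA] by blast
    obtain P' where P': "\<And>z j. j \<le> d \<Longrightarrow> poly (R j) z \<noteq> 0 \<Longrightarrow> poly P' z =
        (\<Sum>i\<le>d. poly (- (B' i ^ q)) z * (poly (R j) z * s (proj_point (infinite_vec z)) (coord_ratio i j)))"
      using pairing_polynomial[OF f fX s(2,1) chart_in_P1(2) R B'R] by blast
    \<comment> \<open>The exponent 0 expresses that the pairing is a section of O; written this way,
      the degree bound applies with \<open>e = 0\<close>.\<close>
    have PP': "poly P t = t ^ 0 * poly P' (inverse t)" if "t \<noteq> 0" for t
    proof -
      obtain k where k: "k \<le> d" "poly (F k) t \<noteq> 0" using nzF by blast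
      have Rk: "poly (R k) (inverse t) \<noteq> 0" using FR[OF k(1) that] k(2) by auto
      define \<xi> where "\<xi> i = s (proj_point (affine_vec t)) (coord_ratio i k)" for i
      have \<xi>': "s (proj_point (infinite_vec (inverse t))) (coord_ratio i k) = \<xi> i" for i
        unfolding \<xi>_def affine_point_eq[OF that] ..
      have sT: "s (proj_point (affine_vec t)) \<in> tangent_space d (fermat_hypersurface d) (proj_point (u t))"
        using s(1)[OF chart_in_P1(1), of t] u(1)[of t] unfolding X_def by simp
      have "u t k \<noteq> 0" using k by (simp add: u_def)
      from fermat_tangent_equation[OF q0 d uX k(1) this sT]
      have tangent: "(\<Sum>i\<le>d. poly (F i) t ^ q * \<xi> i) = 0" by (simp add: u_def \<xi>_def)
      \<comment> \<open>\<open>A ^ q\<close> and \<open>- (B' ^ q)\<close> are the same functional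
        in two charts. They differ by a multiple of \<open>F ^ q\<close>, which drops out after
        summation by \<open>tangent\<close>; the powers of \<open>t\<close> balance because of
        \<open>eq\<close>.\<close>
      have key: "t ^ (q * (m + e)) * (poly (A i) t ^ q * (poly (F k) t * \<xi> i))
          = poly G t ^ q * poly (F k) t * (poly (F i) t ^ q * \<xi> i)
            + t ^ (q * (m + e)) * (poly (- (B' i ^ q)) (inverse t) * (poly (R k) (inverse t) * \<xi> i))"
        if "i \<le> d" for i
      proof -
        have "poly G t * poly (F i) t = t ^ (m + e) * poly (A i) t + poly (B i) t"
          using arg_cong[OF GAB[OF that], of "\<lambda>p. poly p t"] by (simp add: poly_monom)
        then have "(poly G t * poly (F i) t) ^ q = (t ^ (m + e) * poly (A i) t) ^ q + poly (B i) t ^ q"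
          by (simp only: frob)
        then have 1: "t ^ (q * (m + e)) * poly (A i) t ^ q
            = poly G t ^ q * poly (F i) t ^ q - poly (B i) t ^ q"
          by (simp add: power_mult_distrib power_mult[symmetric] mult.commute)
        have "poly (B i) t = t ^ e * poly (B' i) (inverse t)"
          using B'[OF that, of "inverse t"] \<open>t \<noteq> 0\<close> by (simp add: power_inverse[symmetric] field_simps)
        then have 2: "poly (B i) t ^ q * poly (F k) t
            = t ^ (q * (m + e)) * (poly (B' i) (inverse t) ^ q * poly (R k) (inverse t))"
          unfolding FR[OF k(1) \<open>t \<noteq> 0\<close>] eq by (simp add: power_mult_distrib power_mult power_add)
        have "t ^ (q * (m + e)) * (poly (A i) t ^ q * (poly (F k) t * \<xi> i))
            = (t ^ (q * (m + e)) * poly (A i) t ^ q) * poly (F k) t * \<xi> i" by simp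
        also have "\<dots> = poly G t ^ q * poly (F k) t * (poly (F i) t ^ q * \<xi> i)
            - (poly (B i) t ^ q * poly (F k) t) * \<xi> i"
          unfolding 1 by (simp add: algebra_simps)
        finally show ?thesis unfolding 2 by simp
      qed
      have "t ^ (q * (m + e)) * poly P t
          = (\<Sum>i\<le>d. t ^ (q * (m + e)) * (poly (A i) t ^ q * (poly (F k) t * \<xi> i)))"
        unfolding P[OF k] \<xi>_def sum_distrib_left by simp
      also have "\<dots> = (\<Sum>i\<le>d. poly G t ^ q * poly (F k) t * (poly (F i) t ^ q * \<xi> i)
            + t ^ (q * (m + e)) * (poly (- (B' i ^ q)) (inverse t) * (poly (R k) (inverse t) * \<xi> i)))"
        by (intro sum.cong refl key) simp
      also have "\<dots> = t ^ (q * (m + e)) * poly P' (inverse t)"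
        unfolding sum.distrib sum_distrib_left[symmetric] tangent P'[OF k(1) Rk] \<xi>' by simp
      finally show ?thesis using that by simp
    qed
    have "degree P = 0" using degree_le_if_reversible(1)[OF PP'] by simp
    then obtain c where c: "P = [:c:]" by (metis degree_eq_zeroE)
    have "P' = [:c:]"
    proof (rule poly_eqI_cofinite, rule finite_subset)
      show "{z. poly P' z \<noteq> poly [:c:] z} \<subseteq> {0}"
        using PP'[of "inverse z" for z] c by auto
    qed simp
    moreover have "poly P' 0 = 0" using P'[OF i0] s(4) by simp
    ultimately have "poly P t0 = 0" using c by simp
    then show ?thesis using P[OF j] s(3) by simp
  qed
  obtain i j where ij: "i \<le> d" "j \<le> d" "A i * F j \<noteq> A j * F i" using nonprop by blast
  have "\<exists>t. poly (A i * F j) t \<noteq> poly (A j * F i) t"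
  proof (rule ccontr)
    assume "\<not> ?thesis"
    then have "{t. poly (A i * F j) t \<noteq> poly (A j * F i) t} = {}" by blast
    then have "A i * F j = A j * F i" by (intro poly_eqI_cofinite) (simp only: finite.emptyI)
    with ij(3) show False by blast
  qed
  then obtain t where t: "poly (A i * F j) t \<noteq> poly (A j * F i) t" by blast
  have "i \<noteq> j" using ij by auto
  obtain k where k: "k \<le> d" "poly (F k) t \<noteq> 0" using nzF by blast
  \<comment> \<open>A Koszul vector: it satisfies the tangency equation identically, and its pairing
    with \<open>A ^ q\<close> is the \<open>q\<close>-th power of a 2 by 2 minor of \<open>A\<close>
    and \<open>F\<close>.\<close>
  define w where "w l = (if l = i then u t j ^ q else if l = j then - (u t i ^ q) else 0)" for l
  have w_sum: "(\<Sum>l\<le>d. g l * w l) = g i * u t j ^ q - g j * u t i ^ q" for g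
  proof -
    have "(\<Sum>l\<le>d. g l * w l) = (\<Sum>l\<in>{i, j}. g l * w l)"
      by (rule sum.mono_neutral_right) (use ij in \<open>auto simp: w_def\<close>)
    then show ?thesis using \<open>i \<noteq> j\<close> by (simp add: w_def)
  qed
  have "w l = 0" if "l > d" for l using that ij by (auto simp: w_def)
  moreover have "(\<Sum>l\<le>d. u t l ^ q * w l) = 0" unfolding w_sum by (simp add: mult.commute)
  ultimately obtain D where D: "D \<in> tangent_space d X (proj_point (u t))"
    "\<And>l k. l \<le> d \<Longrightarrow> k \<le> d \<Longrightarrow> u t k \<noteq> 0 \<Longrightarrow>
      w l = u t l / u t k * w k + D (coord_ratio l k) * u t k"
    using fermat_tangent_vector[OF q0 qpos d u(2,3) uX, of w t] unfolding X_def by blast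
  have uk: "u t k \<noteq> 0" "poly (F k) t = u t k" using k by (auto simp: u_def)
  \<comment> \<open>\<open>w\<close> and the chart lift of \<open>D\<close> differ by a multiple of
    \<open>u t\<close>, on which the functional vanishes.\<close>
  have AFt: "(\<Sum>l\<le>d. poly (A l) t ^ q * u t l) = 0"
    using arg_cong[OF AF, of "\<lambda>p. poly p t"] by (simp add: poly_sum u_def)
  have "(\<Sum>l\<le>d. poly (A l) t ^ q * w l)
      = (\<Sum>l\<le>d. w k / u t k * (poly (A l) t ^ q * u t l)
          + poly (A l) t ^ q * (poly (F k) t * D (coord_ratio l k)))"
  proof (intro sum.cong refl)
    fix l assume "l \<in> {..d}"
    then have wl: "w l = u t l / u t k * w k + D (coord_ratio l k) * u t k"
      by (intro D(2)[OF _ k(1) uk(1)]) simp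
    show "poly (A l) t ^ q * w l = w k / u t k * (poly (A l) t ^ q * u t l)
          + poly (A l) t ^ q * (poly (F k) t * D (coord_ratio l k))"
      unfolding uk(2) by (subst wl) (simp add: algebra_simps)
  qed
  also have "\<dots> = 0"
    unfolding sum.distrib sum_distrib_left[symmetric] AFt pairing[OF D(1) k] by simp
  finally have "poly (A i) t ^ q * u t j ^ q = poly (A j) t ^ q * u t i ^ q"
    unfolding w_sum by simp
  then have pow: "poly (A i * F j) t ^ q = poly (A j * F i) t ^ q"
    using ij by (simp add: u_def power_mult_distrib)
  \<comment> \<open>Frobenius is additive and injective, so equal \<open>q\<close>-th powers give a
    vanishing minor, contrary to the choice of \<open>t\<close>.\<close>
  have "(poly (A i * F j) t - poly (A j * F i) t) ^ q + poly (A j * F i) t ^ q = poly (A i * F j) t ^ q"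
    unfolding frob[symmetric] by simp
  then have "(poly (A i * F j) t - poly (A j * F i) t) ^ q = 0" unfolding pow by simp
  then show False using t by simp
qed

theorem corollary1p8:
  fixes p r d :: nat and N0 :: int and X :: "'k::alg_closed_field ppoint set"
  assumes "CHAR('k) = p" and "p > 0"
    and "r \<ge> 1" and "p ^ r + 1 > 3"
    and "d = p ^ r + 1"
    and "X = fermat_hypersurface d"
    and "\<forall>e::int. e \<ge> N0 \<longrightarrow>
           (\<exists>f. rational_curve d X f \<and> very_free d X f \<and> curve_degree d f e)"
  shows "N0 > int (p ^ r) * (int (p ^ r) - 1)"
proof (rule ccontr)
  assume "\<not> ?thesis"
  moreover have "int (p ^ r * (p ^ r - 1)) = int (p ^ r) * (int (p ^ r) - 1)"
    using assms(4) by (simp add: of_nat_diff)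
  ultimately have "N0 \<le> int (p ^ r * (p ^ r - 1))" by linarith
  then obtain f where "rational_curve d X f" "very_free d X f"
    "curve_degree d f (int (p ^ r * (p ^ r - 1)))"
    using assms(7) by blast
  moreover have "prime CHAR('k)" using assms(1,2) by (intro prime_CHAR_semidom) simp
  ultimately show False
    using fermat_not_very_free[of "p ^ r" r d f] assms by simp
qed

end
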